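(* Let $k\ge1$ be an integer, $d=2k+1$, and let $\lambda,\mu\in\mathbb{R}$ satisfy $\mu>0$, $d\lambda+2\mu>0$. Put $\alpha:=\frac{\mu}{\lambda+2\mu}$, and let $\gamma_R:=\sqrt{w_1}$, where $w_1$ is the unique real root in $(0,1)$ of $w^3-8w^2+8(3-2\alpha)w+16(\alpha-1)=0$. Then the quantities $$b_{\mathrm{Dir}}=-\frac{\mu^{\frac{1-d}{2}}}{2^{d+1}\pi^{\frac{d-1}{2}}\Gamma\left(\frac{d+1}{2}\right)}\left(\frac{4(d-1)}{\pi}\int_{\sqrt{\alpha}}^1\tau^{d-2}\arctan\left(\sqrt{(1-\alpha\tau^{-2})(\tau^{-2}-1)}\right)d\tau+\alpha^{\frac{d-1}{2}}+d-1\right)$$ and $$b_{\mathrm{free}}=\frac{\mu^{\frac{1-d}{2}}}{2^{d+1}\pi^{\frac{d-1}{2}}\Gamma\left(\frac{d+1}{2}\right)}\left(\frac{4(d-1)}{\pi}\int_{\sqrt{\alpha}}^1\tau^{d-2}\arctan\left(\frac{(\tau^{-2}-2)^2}{4\sqrt{(1-\alpha\tau^{-2})(\tau^{-2}-1)}}\right)d\tau+\alpha^{\frac{d-1}{2}}+d-5+4\gamma_R^{1-d}\right)$$ can be rewritten as $$b_{\mathrm{Dir}}=-\frac{\mu^{-k}}{2^{2k+2}\,k!\,\pi^k}\left(\frac{2}{k!}\frac{d^k}{dt^k}\left(\frac{2t-\frac{\alpha+1}{\alpha}}{t-\frac{\alpha+1}{\alpha}}\,\frac{1}{\sqrt{(1-\alpha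 t)(1-t)}}\right)\bigg|_{t=0}-2\left(\frac{\alpha}{\alpha+1}\right)^k+\alpha^k+2k\right)$$ and $$b_{\mathrm{free}}=\frac{\mu^{-k}}{2^{2k+2}\,k!\,\pi^k}\left(-\frac{8}{k!}\frac{d^k}{dt^k}\left(\frac{\left(2\alpha t^2+(\alpha-3)t+2(1-\alpha)\right)\left(4\sqrt{(1-\alpha t)(1-t)}+(t-2)^2\right)}{(t-2)\left(t^3-8t^2+8(3-2\alpha)t+16(\alpha-1)\right)\sqrt{(1-\alpha t)(1-t)}}\right)\bigg|_{t=0}-\alpha^k+2\left(k+2^{2-k}-1\right)\right).$$
   Context: The conditions on $\lambda,\mu$ imply $\alpha\in(0,1)$. Square roots are the non-negative real square roots. The quantities $b_{\mathrm{Dir}}$ and $b_{\mathrm{free}}$ are the second Weyl coefficients of the linear elasticity operator with Dirichlet and free boundary conditions in dimension $d$; for this statement they are simply the numbers given by the integral formulas in the claim. *)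

theory Defs
  imports "HOL-Analysis.Analysis"
begin

definition elastic_alpha :: "real \<Rightarrow> real \<Rightarrow> real" where
  "elastic_alpha lam mu = mu / (lam + 2 * mu)"

lemma elastic_alpha_bounds:
  fixes lam mu :: real and d :: nat
  assumes "d \<ge> 2" "mu > 0" "real d * lam + 2 * mu > 0"
  shows "0 < elastic_alpha lam mu" "elastic_alpha lam mu < 1"
proof -
  have "lam + mu > 0"
  proof (cases "lam \<ge> 0")
    case False
    then have "real d * lam \<le> 2 * lam"
      using assms(1) by (intro mult_right_mono_neg) auto
    then show ?thesis using assms(3) by linarith
  qed (use assms(2) in auto)
  then show "0 < elastic_alpha lam mu" "elastic_alpha lam mu < 1"
    using assms(2) by (auto simp: elastic_alpha_def field_simps)
qed

definition rayleigh_cubic :: "real \<Rightarrow> real \<Rightarrow> real" where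
  "rayleigh_cubic \<alpha> w = w ^ 3 - 8 * w\<^sup>2 + 8 * (3 - 2 * \<alpha>) * w + 16 * (\<alpha> - 1)"

definition rayleigh_root :: "real \<Rightarrow> real" where
  "rayleigh_root \<alpha> = (THE w. 0 < w \<and> w < 1 \<and> rayleigh_cubic \<alpha> w = 0)"

definition gamma_R :: "real \<Rightarrow> real" where
  "gamma_R \<alpha> = sqrt (rayleigh_root \<alpha>)"

text \<open>The definite description above is well defined for every admissible \<open>\<alpha>\<close>.\<close>

lemma rayleigh_root_ex1:
  fixes \<alpha> :: real
  assumes "0 < \<alpha>" "\<alpha> < 1"
  shows "\<exists>!w. 0 < w \<and> w < 1 \<and> rayleigh_cubic \<alpha> w = 0"
proof -
  have "\<exists>w\<ge>0. w \<le> 1 \<and> rayleigh_cubic \<alpha> w = 0"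
    using assms by (intro IVT') (auto simp: rayleigh_cubic_def intro!: continuous_intros)
  then obtain w where w: "0 \<le> w" "w \<le> 1" "rayleigh_cubic \<alpha> w = 0" by blast
  have "w \<noteq> 0" "w \<noteq> 1"
    using w(3) assms by (auto simp: rayleigh_cubic_def)
  with w have ex: "0 < w \<and> w < 1 \<and> rayleigh_cubic \<alpha> w = 0" by auto
  have less: False
    if "0 < x" "x < y" "y < 1" "rayleigh_cubic \<alpha> x = 0" "rayleigh_cubic \<alpha> y = 0" for x y
  proof -
    have "(1 - y) * rayleigh_cubic \<alpha> x - (1 - x) * rayleigh_cubic \<alpha> y =
        (x - y) * (1 + (1 - x) * (1 - y) * (5 + (1 - x) + (1 - y)))"
      by (simp add: rayleigh_cubic_def algebra_simps power2_eq_square power3_eq_cube)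
    moreover have "(1 - x) * (1 - y) * (5 + (1 - x) + (1 - y)) > 0"
      using that by (intro mult_pos_pos) auto
    ultimately have "x - y = 0"
      using that(4,5) by (metis add_pos_pos diff_self less_irrefl mult_eq_0_iff mult_zero_right zero_less_one)
    then show False using that(2) by simp
  qed
  show ?thesis
  proof (rule ex1I[of _ w])
    show "v = w" if "0 < v \<and> v < 1 \<and> rayleigh_cubic \<alpha> v = 0" for v
      using that ex less[of v w] less[of w v] by (cases v w rule: linorder_cases) auto
  qed (fact ex)
qed

definition b_Dir :: "nat \<Rightarrow> real \<Rightarrow> real \<Rightarrow> real" where
  "b_Dir d lam mu = (let \<alpha> = elastic_alpha lam mu in
     - (mu powr ((1 - real d) / 2) /
        (2 ^ (d + 1) * pi powr ((real d - 1) / 2) * Gamma ((real d + 1) / 2))) *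
     (4 * (real d - 1) / pi *
        integral {sqrt \<alpha>..1}
          (\<lambda>\<tau>. \<tau> ^ (d - 2) *
             arctan (sqrt ((1 - \<alpha> * \<tau> powi (-2)) * (\<tau> powi (-2) - 1))))
      + \<alpha> powr ((real d - 1) / 2) + real d - 1))"

text \<open>In the integrand below the denominator vanishes only at the two endpoints, so the value
  \<open>arctan 0\<close> which totalised division gives there does not affect the integral.\<close>

definition b_free :: "nat \<Rightarrow> real \<Rightarrow> real \<Rightarrow> real" where
  "b_free d lam mu = (let \<alpha> = elastic_alpha lam mu in
     mu powr ((1 - real d) / 2) /
       (2 ^ (d + 1) * pi powr ((real d - 1) / 2) * Gamma ((real d + 1) / 2)) *
     (4 * (real d - 1) / pi *
        integral {sqrt \<alpha>..1}
          (\<lambda>\<tau>. \<tau> ^ (d - 2) *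
             arctan ((\<tau> powi (-2) - 2)\<^sup>2 /
               (4 * sqrt ((1 - \<alpha> * \<tau> powi (-2)) * (\<tau> powi (-2) - 1)))))
      + \<alpha> powr ((real d - 1) / 2) + real d - 5 + 4 * gamma_R \<alpha> powi (1 - int d)))"

end

theory Submission
  imports Defs
begin

text \<open>
  Write \<open>p(t) = (1 - \<alpha> t)(1 - t)\<close>. In each coefficient, substitute \<open>t = \<tau>\<^sup>-\<^sup>2\<close> and integrate by parts.
  The arctangent has an algebraic derivative of the form \<open>S(t) / (t \<surd>(-p(t)))\<close> with \<open>S\<close> rational, so
  what remains is a negative moment \<open>\<kappa>\<^sub>k\<close>, the mean of \<open>S(t) t\<^sup>-\<^sup>k\<^sup>-\<^sup>1\<close> under the arcsine law
  \<open>dt / (\<pi> \<surd>(-p(t)))\<close> on \<open>[1, 1/\<alpha>]\<close> (\<open>power_integral_by_parts\<close>). The geometric series turns the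
  numbers \<open>\<kappa>\<^sub>n\<close> into the Taylor coefficients at \<open>0\<close> of the Cauchy transform
  \<open>K(z) = mean of S(t) / (t - z)\<close> (\<open>cauchy_transform_sums\<close>).

  Expanding \<open>S\<close> into partial fractions with poles \<open>w\<^sub>i\<close> and residues \<open>a\<^sub>i\<close> expresses \<open>K\<close> through the
  single function \<open>J(w) = mean of 1 / (t - w)\<close>:
  \<open>K(z) = S(z) J(z) - \<Sum> a\<^sub>i J(w\<^sub>i) / (z - w\<^sub>i)\<close> (\<open>cauchy_transform_partial_fractions\<close>).
  The Joukowski substitution and the Poisson kernel give \<open>J(w)\<^sup>2 p(w) = 1\<close> off the cut
  (\<open>cauchy_transform_squared\<close>), and the sign of the root follows from the sign of \<open>1 / (t - w)\<close> or of
  its imaginary part. The term \<open>S(z) J(z) = S(z) / \<surd>p(z)\<close> yields the functions that are differentiated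
  in the theorem, and the simple poles yield the explicit geometric terms.

  For the Dirichlet coefficient \<open>S\<close> has the single pole \<open>c = (\<alpha> + 1) / \<alpha>\<close>, where \<open>J(c) = -1\<close>.

  For the free coefficient \<open>S\<close> is \<open>(t - 2) P / C\<close> up to a constant factor, where \<open>C\<close> is the Rayleigh cubic
  and \<open>P\<close> the quadratic in the numerator. Its poles are the three roots of \<open>C\<close>. There
  \<open>16 p(w) = (w - 2)\<^sup>4\<close>, so \<open>J(w) = \<plusminus>4 / (w - 2)\<^sup>2\<close>, with the sign plus exactly at the root in \<open>(0, 1)\<close>
  (\<open>rayleigh_residue_inner\<close>, \<open>rayleigh_residue_outer\<close>). The rational function
  \<open>4 P / ((t - 2) C)\<close>, the other part of the function differentiated in the theorem, has residues
  \<open>w\<^sub>i / 4\<close> at the same three points. It therefore cancels the two outer roots and doubles the inner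
  one, whose contribution is the power of \<open>\<gamma>\<^sub>R\<close>; its pole at \<open>2\<close> gives the power of two. The
  partial fraction identities rest on Vieta's formulas, so the roots may be complex or coincide.

  At \<open>\<alpha> = 1/2\<close> an outer root sits at the end point \<open>1/\<alpha> = 2\<close> of the cut. Its residue vanishes, so the
  pole term is lost, but the boundary angle there is \<open>0\<close> in place of \<open>\<pi>/2\<close>; the two changes cancel.
\<close>

section \<open>Power series and elementary integrals\<close>

text \<open>Differentiating termwise shifts the coefficients, so induction on the order reads off one Taylor
  coefficient. The function is known only on a neighbourhood of \<open>0\<close>.\<close>

lemma higher_deriv_at_0_of_sums:
  fixes a :: "nat \<Rightarrow> real"
  assumes "R > 0" and "\<And>z. \<bar>z\<bar> < R \<Longrightarrow> (\<lambda>n. a n * z ^ n) sums f z"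
  shows "(deriv ^^ k) f 0 = fact k * a k"
  using assms(2)
proof (induction k arbitrary: a f)
  case 0
  have "(\<lambda>n. a n * 0 ^ n) sums f 0" using 0[of 0] assms(1) by simp
  then show ?case using powser_sums_zero sums_unique2 by fastforce
next
  case (Suc k)
  have D: "(\<lambda>n. diffs a n * z ^ n) sums deriv f z" if z: "\<bar>z\<bar> < R" for z
  proof -
    have "((\<lambda>x. \<Sum>n. a n * x ^ n) has_field_derivative (\<Sum>n. diffs a n * z ^ n)) (at z)"
      using Suc.prems z by (intro termdiffs_strong'[where K = R]) (auto simp: sums_iff)
    then have "(f has_field_derivative (\<Sum>n. diffs a n * z ^ n)) (at z)"
      by (rule has_field_derivative_transform_within_open[where S = "{-R<..<R}"])
        (use Suc.prems z in \<open>auto simp: sums_iff abs_less_iff\<close>)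
    then have "deriv f z = (\<Sum>n. diffs a n * z ^ n)" by (rule DERIV_imp_deriv)
    moreover have "summable (\<lambda>n. diffs a n * z ^ n)"
      using Suc.prems z by (intro termdiff_converges[where K = R]) (auto simp: sums_iff)
    ultimately show ?thesis by (simp add: sums_iff)
  qed
  have "(deriv ^^ Suc k) f 0 = (deriv ^^ k) (deriv f) 0" by (simp add: funpow_Suc_right del: funpow.simps)
  also have "\<dots> = fact k * diffs a k" using D by (rule Suc.IH)
  finally show ?case by (simp add: diffs_def algebra_simps)
qed

lemma geometric_sums_shifted:
  fixes c z :: real
  assumes "\<bar>z\<bar> < c"
  shows "(\<lambda>n. (1 / c) ^ n * z ^ n) sums (c / (c - z))"
proof -
  have "norm (z / c) < 1" using assms by simp
  from geometric_sums[OF this] show ?thesis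
    using assms by (simp add: power_divide divide_simps split: if_splits)
qed

text \<open>The right-hand side remains continuous where \<open>x\<close> vanishes but \<open>y\<close> does not; it serves to extend
  the angle of the point \<open>(x, y)\<close> to the imaginary axis.\<close>

lemma arctan_divide_half:
  assumes "x > 0"
  shows "arctan (y / x) = 2 * arctan (y / (x + sqrt (x\<^sup>2 + y\<^sup>2)))"
proof -
  have "x\<^sup>2 + y\<^sup>2 = x\<^sup>2 * (1 + (y / x)\<^sup>2)" using assms by (simp add: power_divide field_simps)
  then have "sqrt (x\<^sup>2 + y\<^sup>2) = x * sqrt (1 + (y / x)\<^sup>2)"
    using assms by (simp add: real_sqrt_mult)
  then have "y / (x + sqrt (x\<^sup>2 + y\<^sup>2)) = y / (x * (1 + sqrt (1 + (y / x)\<^sup>2)))"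
    by (simp add: distrib_left)
  also have "\<dots> = y / x / (1 + sqrt (1 + (y / x)\<^sup>2))" by simp
  finally have e: "y / (x + sqrt (x\<^sup>2 + y\<^sup>2)) = y / x / (1 + sqrt (1 + (y / x)\<^sup>2))" .
  show ?thesis unfolding e by (rule arctan_half)
qed

text \<open>The kernel is \<open>1 + \<Sum> 2 \<rho>\<^sup>n cos (n \<theta>)\<close> divided by \<open>1 - \<rho>\<^sup>2\<close>. Integrating the series termwise and summing
  gives a primitive in terms of \<open>Ln (1 - \<rho> exp (\<plusminus>\<i> \<theta>))\<close>, which is smooth because the argument stays in
  the right half-plane; the logarithms cancel at both ends.\<close>

lemma has_integral_poisson_kernel:
  fixes \<rho> :: complex
  assumes \<rho>: "norm \<rho> < 1"
  shows "((\<lambda>\<theta>. 1 / (1 - 2 * \<rho> * of_real (cos \<theta>) + \<rho>\<^sup>2)) has_integral of_real pi / (1 - \<rho>\<^sup>2)) {0..pi}"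
proof -
  define F where "F = (\<lambda>z. (z + \<i> * Ln (1 - \<rho> * exp (\<i> * z)) - \<i> * Ln (1 - \<rho> * exp (- \<i> * z))) / (1 - \<rho>\<^sup>2))"
  have "((\<lambda>\<theta>. 1 / (1 - 2 * \<rho> * of_real (cos \<theta>) + \<rho>\<^sup>2)) has_integral F (of_real pi) - F (of_real 0)) {0..pi}"
  proof (rule fundamental_theorem_of_calculus)
    fix \<theta> :: real
    define E where "E = exp (\<i> * of_real \<theta>)"
    define E' where "E' = exp (- \<i> * of_real \<theta>)"
    have norms: "norm E = 1" "norm E' = 1" by (auto simp: E_def E'_def)
    have EE: "E * E' = 1" by (simp add: E_def E'_def exp_minus)
    have cosE: "2 * of_real (cos \<theta>) = E + E'"
      by (simp add: cos_of_real[symmetric] cos_exp_eq E_def E'_def)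
    have slit: "1 - \<rho> * e \<notin> \<real>\<^sub>\<le>\<^sub>0" if "norm e = 1" for e
    proof -
      have "Re (\<rho> * e) < 1" using complex_Re_le_cmod[of "\<rho> * e"] \<rho> that by (simp add: norm_mult)
      then show ?thesis by (auto simp: complex_nonpos_Reals_iff)
    qed
    then have nz: "1 - \<rho> * E \<noteq> 0" "1 - \<rho> * E' \<noteq> 0" using norms by fastforce+
    have "norm (\<rho>\<^sup>2) < 1" using \<rho> by (simp add: norm_power power_less_one_iff)
    then have nz2: "1 - \<rho>\<^sup>2 \<noteq> 0" by auto
    have ii: "1 + \<i> * (- (x * \<i>) / y) - \<i> * ((x' * \<i>) / y') = 1 + x / y + x' / y'" for x y x' y' :: complex
      by (simp add: divide_inverse algebra_simps)
    have "((\<lambda>z. (z + \<i> * Ln (1 - \<rho> * exp (\<i> * z)) - \<i> * Ln (1 - \<rho> * exp (- \<i> * z)))) has_field_derivative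
        1 + \<i> * (- (\<rho> * E * \<i>) / (1 - \<rho> * E)) - \<i> * ((\<rho> * E' * \<i>) / (1 - \<rho> * E'))) (at (of_real \<theta>))"
      using slit[of E] slit[of E'] norms
      by (auto intro!: derivative_eq_intros simp: E_def E'_def divide_inverse mult_ac)
    from DERIV_cdivide[OF this, of "1 - \<rho>\<^sup>2"]
    have "(F has_field_derivative (1 + \<rho> * E / (1 - \<rho> * E) + \<rho> * E' / (1 - \<rho> * E')) / (1 - \<rho>\<^sup>2)) (at (of_real \<theta>))"
      unfolding F_def ii .
    also have "1 + \<rho> * E / (1 - \<rho> * E) + \<rho> * E' / (1 - \<rho> * E')
        = (1 - \<rho>\<^sup>2 * (E * E')) / ((1 - \<rho> * E) * (1 - \<rho> * E'))"
      using nz by (simp add: divide_simps) (simp add: algebra_simps power2_eq_square)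
    also have "\<dots> / (1 - \<rho>\<^sup>2) = 1 / ((1 - \<rho> * E) * (1 - \<rho> * E'))"
      using nz2 by (simp add: EE)
    also have "(1 - \<rho> * E) * (1 - \<rho> * E') = 1 - 2 * \<rho> * of_real (cos \<theta>) + \<rho>\<^sup>2"
    proof -
      have "(1 - \<rho> * E) * (1 - \<rho> * E') = 1 - \<rho> * (E + E') + \<rho>\<^sup>2 * (E * E')"
        by (simp add: algebra_simps power2_eq_square)
      then show ?thesis by (simp add: EE flip: cosE)
    qed
    finally show "((\<lambda>x. F (of_real x)) has_vector_derivative 1 / (1 - 2 * \<rho> * of_real (cos \<theta>) + \<rho>\<^sup>2)) (at \<theta> within {0..pi})"
      by (rule has_vector_derivative_real_field)
  qed simp
  moreover have "exp (- \<i> * of_real pi) = - 1" "exp (\<i> * of_real pi) = - 1"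
    using exp_pi_i by (simp_all add: exp_minus mult.commute)
  then have "F (of_real pi) = of_real pi / (1 - \<rho>\<^sup>2)" unfolding F_def by simp
  moreover have "F (of_real 0) = 0" by (simp add: F_def)
  ultimately show ?thesis by simp
qed

text \<open>The two roots of the quadratic have product \<open>1\<close>, so one of them lies inside the unit circle unless
  both lie on it, and then \<open>v\<close> would be the cosine of a real angle.\<close>

lemma joukowski_inverse:
  fixes v :: complex
  assumes "v \<notin> of_real ` {-1..1}"
  obtains \<rho> where "norm \<rho> < 1" "\<rho> \<noteq> 0" "2 * v * \<rho> = 1 + \<rho>\<^sup>2"
proof -
  define s where "s = csqrt (v\<^sup>2 - 1)"
  have prod: "(v - s) * (v + s) = 1"
    using power2_csqrt[of "v\<^sup>2 - 1"] by (simp add: s_def algebra_simps power2_eq_square)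
  have root: "2 * v * \<rho> = 1 + \<rho>\<^sup>2" "\<rho> \<noteq> 0" if "\<rho> = v - s \<or> \<rho> = v + s" for \<rho>
  proof -
    from that have "\<rho> * (2 * v - \<rho>) = 1"
    proof
      assume "\<rho> = v + s"
      then show ?thesis using prod by (simp add: mult.commute)
    qed (use prod in simp)
    then show "2 * v * \<rho> = 1 + \<rho>\<^sup>2" "\<rho> \<noteq> 0" by (auto simp: algebra_simps power2_eq_square)
  qed
  have no1: "norm \<rho> \<noteq> 1" if "\<rho> = v - s \<or> \<rho> = v + s" for \<rho>
  proof
    assume n: "norm \<rho> = 1"
    have "\<rho> * cnj \<rho> = 1" using n by (simp add: complex_norm_square[symmetric])
    then have "2 * v * \<rho> = \<rho> * (cnj \<rho> + \<rho>)" using root[OF that] by (simp add: algebra_simps power2_eq_square)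
    then have "v = of_real (Re \<rho>)" using root(2)[OF that] by (simp add: complex_add_cnj add.commute)
    moreover have "\<bar>Re \<rho>\<bar> \<le> 1" using abs_Re_le_cmod[of \<rho>] n by simp
    ultimately show False using assms by (auto simp: abs_le_iff)
  qed
  have "norm (v - s) * norm (v + s) = 1" using prod by (metis norm_mult norm_one)
  then have "norm (v - s) < 1 \<or> norm (v + s) < 1"
    using no1[of "v - s"] no1[of "v + s"] mult_mono[of 1 "norm (v - s)" 1 "norm (v + s)"]
    by (metis less_1_mult less_irrefl linorder_neqE_linordered_idom)
  then show ?thesis using that root by blast
qed

section \<open>Roots of the Rayleigh cubic\<close>

text \<open>The quadratic \<open>P\<close> arises from differentiating the angle. It is tied to the Rayleigh cubic \<open>C\<close> by
  \<open>w (w - 2) C'(w) = 16 P(w)\<close> at every root \<open>w\<close>, which makes the residues below simple.\<close>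

definition rayleigh_numerator :: "real \<Rightarrow> real \<Rightarrow> real" where
  "rayleigh_numerator \<alpha> t = 2 * \<alpha> * t\<^sup>2 + (\<alpha> - 3) * t + 2 * (1 - \<alpha>)"

text \<open>Here \<open>w0\<close>, \<open>w1\<close>, \<open>w2\<close> are the roots of the Rayleigh cubic with parameter \<open>a\<close>, described by Vieta's
  formulas. The last two identities are the partial fraction expansions of \<open>4 P / ((t - 2) C)\<close> and
  \<open>(t - 2) P / C\<close> with denominators cleared; in this form they hold for multiple roots as well.\<close>

context
  fixes w0 w1 w2 a :: "'a::field_char_0"
  assumes v1: "w0 + w1 + w2 = 8" and v2: "w0 * w1 + w0 * w2 + w1 * w2 = 24 - 16 * a"
    and v3: "w0 * w1 * w2 = 16 * (1 - a)"
begin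

lemma rayleigh_cubic_of_roots: "(t - w0) * (t - w1) * (t - w2) = t ^ 3 - 8 * t\<^sup>2 + 8 * (3 - 2 * a) * t + 16 * (a - 1)"
proof -
  have "(t - w0) * (t - w1) * (t - w2) = t ^ 3 - (w0 + w1 + w2) * t\<^sup>2 +
      (w0 * w1 + w0 * w2 + w1 * w2) * t - w0 * w1 * w2"
    by (simp add: algebra_simps power2_eq_square power3_eq_cube)
  then show ?thesis unfolding v1 v2 v3 by (simp add: algebra_simps)
qed

lemma rayleigh_numerator_of_roots: "16 * (2 * a * t\<^sup>2 + (a - 3) * t + 2 * (1 - a)) + 8 * ((t - w0) * (t - w1) * (t - w2)) =
      (t - 2) * (w0 * (t - w1) * (t - w2) + w1 * (t - w0) * (t - w2) + w2 * (t - w0) * (t - w1))"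
proof -
  have "w0 * (t - w1) * (t - w2) + w1 * (t - w0) * (t - w2) + w2 * (t - w0) * (t - w1) =
      (w0 + w1 + w2) * t\<^sup>2 - 2 * (w0 * w1 + w0 * w2 + w1 * w2) * t + 3 * (w0 * w1 * w2)"
    by (simp add: algebra_simps power2_eq_square)
  note this[unfolded v1 v2 v3]
  then show ?thesis unfolding rayleigh_cubic_of_roots
    by (simp only:) (simp add: algebra_simps power2_eq_square power3_eq_cube)
qed

lemma shifted_numerator_of_roots: "16 * ((t - 2) * (2 * a * t\<^sup>2 + (a - 3) * t + 2 * (1 - a))) =
      32 * a * ((t - w0) * (t - w1) * (t - w2)) +
      w0 * (w0 - 2)\<^sup>2 * (t - w1) * (t - w2) + w1 * (w1 - 2)\<^sup>2 * (t - w0) * (t - w2) +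
      w2 * (w2 - 2)\<^sup>2 * (t - w0) * (t - w1)"
proof -
  have "w0 * (w0 - 2)\<^sup>2 * (t - w1) * (t - w2) + w1 * (w1 - 2)\<^sup>2 * (t - w0) * (t - w2) +
      w2 * (w2 - 2)\<^sup>2 * (t - w0) * (t - w1) =
      t\<^sup>2 * (p3 - 4 * p2 + 4 * e1) - t * (e1 * (p3 - 4 * p2 + 4 * e1) - (p4 - 4 * p3 + 4 * p2)) + e3 * (p2 - 4 * e1 + 12)"
    if e: "e1 = w0 + w1 + w2" "e2 = w0 * w1 + w0 * w2 + w1 * w2" "e3 = w0 * w1 * w2"
      and p: "p2 = e1\<^sup>2 - 2 * e2" "p3 = e1 ^ 3 - 3 * e1 * e2 + 3 * e3" "p4 = e1 * p3 - e2 * p2 + e3 * e1"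
    for e1 e2 e3 p2 p3 p4
  proof -
    have "p2 = w0\<^sup>2 + w1\<^sup>2 + w2\<^sup>2" unfolding p e by (simp add: algebra_simps power2_eq_square)
    moreover have "p3 = w0 ^ 3 + w1 ^ 3 + w2 ^ 3" unfolding p e by (simp add: algebra_simps power3_eq_cube)
    moreover have "p4 = w0 ^ 4 + w1 ^ 4 + w2 ^ 4"
      unfolding p(3) calculation e by (simp add: algebra_simps power2_eq_square power3_eq_cube power4_eq_xxxx)
    ultimately show ?thesis
      unfolding e by (simp add: algebra_simps power2_eq_square power3_eq_cube power4_eq_xxxx)
  qed
  from this[OF v1[symmetric] v2[symmetric] v3[symmetric] refl refl refl]
  show ?thesis unfolding rayleigh_cubic_of_roots add.assoc[symmetric]
    by (simp add: algebra_simps power2_eq_square power3_eq_cube)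
qed
end

section \<open>The arcsine law on the branch cut\<close>

text \<open>The parametrisation of \<open>[1, 1/\<alpha>]\<close> by an angle. It turns the weight \<open>dt / \<surd>((1 - \<alpha> t)(t - 1))\<close>, which
  is singular at both ends, into \<open>d\<theta> / \<surd>\<alpha>\<close>.\<close>

definition cut_pt :: "real \<Rightarrow> real \<Rightarrow> real" where
  "cut_pt \<alpha> \<theta> = ((1 + \<alpha>) + (1 - \<alpha>) * cos \<theta>) / (2 * \<alpha>)"

definition arcsine_mean :: "real \<Rightarrow> (real \<Rightarrow> 'a::real_normed_vector) \<Rightarrow> 'a" where
  "arcsine_mean \<alpha> g = integral {0..pi} (\<lambda>\<theta>. g (cut_pt \<alpha> \<theta>)) /\<^sub>R (pi * sqrt \<alpha>)"

context
  fixes \<alpha> :: real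
  assumes \<alpha>: "0 < \<alpha>" "\<alpha> < 1"
begin

lemma cut_pt_ends: "cut_pt \<alpha> 0 = 1 / \<alpha>" "cut_pt \<alpha> pi = 1"
  using \<alpha> by (auto simp: cut_pt_def field_simps)

lemma cut_pt_minus_1: "cut_pt \<alpha> \<theta> - 1 = (1 - \<alpha>) * (1 + cos \<theta>) / (2 * \<alpha>)"
  and one_minus_cut_pt: "1 - \<alpha> * cut_pt \<alpha> \<theta> = (1 - \<alpha>) * (1 - cos \<theta>) / 2"
  using \<alpha> by (auto simp: cut_pt_def field_simps)

lemma cut_pt_in: "cut_pt \<alpha> \<theta> \<in> {1..1 / \<alpha>}"
proof -
  have "1 + cos \<theta> \<ge> 0" "1 - cos \<theta> \<ge> 0" using cos_ge_minus_one[of \<theta>] cos_le_one[of \<theta>] by linarith+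
  then have "cut_pt \<alpha> \<theta> - 1 \<ge> 0" "1 - \<alpha> * cut_pt \<alpha> \<theta> \<ge> 0"
    unfolding cut_pt_minus_1 one_minus_cut_pt using \<alpha>
    by (auto intro!: mult_nonneg_nonneg divide_nonneg_pos)
  then show ?thesis using \<alpha> by (auto simp: field_simps)
qed

lemma cut_pt_pos: "cut_pt \<alpha> \<theta> \<ge> 1" "cut_pt \<alpha> \<theta> > 0"
  using cut_pt_in[of \<theta>] by auto

lemma cut_pt_in_open:
  assumes "0 < \<theta>" "\<theta> < pi"
  shows "cut_pt \<alpha> \<theta> \<in> {1<..<1 / \<alpha>}"
proof -
  have "cos \<theta> < 1" "cos \<theta> > - 1"
    using assms cos_monotone_0_pi[of 0 \<theta>] cos_monotone_0_pi[of \<theta> pi] by auto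
  then have "cut_pt \<alpha> \<theta> - 1 > 0" "1 - \<alpha> * cut_pt \<alpha> \<theta> > 0"
    unfolding cut_pt_minus_1 one_minus_cut_pt using \<alpha> by auto
  then show ?thesis using \<alpha> by (auto simp: field_simps)
qed

lemma sqrt_cut_pt:
  assumes "\<theta> \<in> {0..pi}"
  shows "sqrt ((1 - \<alpha> * cut_pt \<alpha> \<theta>) * (cut_pt \<alpha> \<theta> - 1)) = (1 - \<alpha>) * sin \<theta> / (2 * sqrt \<alpha>)"
proof (rule real_sqrt_unique)
  show "0 \<le> (1 - \<alpha>) * sin \<theta> / (2 * sqrt \<alpha>)"
    using assms \<alpha> by (auto intro!: mult_nonneg_nonneg divide_nonneg_pos sin_ge_zero)
  have "((1 - \<alpha>) * sin \<theta> / (2 * sqrt \<alpha>))\<^sup>2 = (1 - \<alpha>)\<^sup>2 * (1 - (cos \<theta>)\<^sup>2) / (4 * \<alpha>)"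
    using \<alpha> by (simp add: power_divide power_mult_distrib sin_squared_eq)
  also have "\<dots> = (1 - \<alpha> * cut_pt \<alpha> \<theta>) * (cut_pt \<alpha> \<theta> - 1)"
    unfolding cut_pt_minus_1 one_minus_cut_pt using \<alpha> by (simp add: power2_eq_square field_simps)
  finally show "((1 - \<alpha>) * sin \<theta> / (2 * sqrt \<alpha>))\<^sup>2 = (1 - \<alpha> * cut_pt \<alpha> \<theta>) * (cut_pt \<alpha> \<theta> - 1)" .
qed

lemma continuous_on_cut_pt [continuous_intros]: "continuous_on A (cut_pt \<alpha>)"
  unfolding cut_pt_def[abs_def] using \<alpha> by (intro continuous_intros) auto

lemma cut_pt_deriv: "(cut_pt \<alpha> has_real_derivative - ((1 - \<alpha>) * sin \<theta> / (2 * \<alpha>))) (at \<theta> within A)"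
  unfolding cut_pt_def[abs_def] using \<alpha> by (auto intro!: derivative_eq_intros simp: field_simps)

text \<open>With \<open>t = \<tau>\<^sup>-\<^sup>2\<close> the left-hand side is the integral of \<open>h\<close> against \<open>d(t\<^sup>-\<^sup>k)\<close>. The substitution is
  carried out in the angle \<open>\<theta>\<close>, where the singular factor of \<open>h'\<close> cancels against the derivative of
  \<open>cut_pt\<close>; hence \<open>h\<close> needs to be differentiable only in the interior.\<close>

lemma power_integral_by_parts:
  assumes k: "k \<ge> 1" and h: "continuous_on {1..1 / \<alpha>} h"
    and h': "\<And>t. 1 < t \<Longrightarrow> t < 1 / \<alpha> \<Longrightarrow>
      (h has_real_derivative S t / (t * sqrt ((1 - \<alpha> * t) * (t - 1)))) (at t)"
  shows "2 * real k * integral {sqrt \<alpha>..1} (\<lambda>\<tau>. \<tau> ^ (2 * k - 1) * h (1 / \<tau>\<^sup>2)) =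
    h 1 - \<alpha> ^ k * h (1 / \<alpha>) + pi * arcsine_mean \<alpha> (\<lambda>t. S t / t ^ Suc k)"
proof -
  define s where "s = (\<lambda>\<theta>. (1 - \<alpha>) * sin \<theta> / (2 * \<alpha>))"
  define P where "P = (\<lambda>\<theta>. real k * s \<theta> / cut_pt \<alpha> \<theta> ^ Suc k * h (cut_pt \<alpha> \<theta>))"
  define Q where "Q = (\<lambda>\<theta>. S (cut_pt \<alpha> \<theta>) / cut_pt \<alpha> \<theta> ^ Suc k)"
  define \<phi> where "\<phi> = (\<lambda>\<theta>. 1 / sqrt (cut_pt \<alpha> \<theta>))"
  have "((\<lambda>\<theta>. (s \<theta> / (2 * cut_pt \<alpha> \<theta> * sqrt (cut_pt \<alpha> \<theta>))) *\<^sub>R (\<phi> \<theta> ^ (2 * k - 1) * h (1 / (\<phi> \<theta>)\<^sup>2)))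
      has_integral integral {\<phi> 0..\<phi> pi} (\<lambda>\<tau>. \<tau> ^ (2 * k - 1) * h (1 / \<tau>\<^sup>2))) {0..pi}"
  proof (rule has_integral_substitution[where c = "sqrt \<alpha>" and d = 1])
    have in1: "\<phi> \<theta> \<in> {sqrt \<alpha>..1}" for \<theta>
      unfolding \<phi>_def using cut_pt_in[of \<theta>] \<alpha>
      by (auto simp: field_simps real_sqrt_mult[symmetric])
    show "\<phi> ` {0..pi} \<subseteq> {sqrt \<alpha>..1}" using in1 by auto
    show "\<phi> 0 \<le> \<phi> pi" using in1[of 0] by (auto simp: \<phi>_def cut_pt_ends)
    show "continuous_on {sqrt \<alpha>..1} (\<lambda>\<tau>. \<tau> ^ (2 * k - 1) * h (1 / \<tau>\<^sup>2))"
    proof (intro continuous_intros continuous_on_compose2[OF h])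
      show "\<forall>x\<in>{sqrt \<alpha>..1}. x\<^sup>2 \<noteq> 0" using \<alpha> by (auto simp: real_sqrt_le_0_iff)
      show "(\<lambda>x. 1 / x\<^sup>2) ` {sqrt \<alpha>..1} \<subseteq> {1..1 / \<alpha>}"
      proof safe
        fix x assume x: "x \<in> {sqrt \<alpha>..1}"
        have "\<alpha> \<le> x\<^sup>2" using x \<alpha> by (auto intro: real_le_rsqrt simp: sqrt_le_D)
        moreover have "x\<^sup>2 \<le> 1" using x \<alpha> order_trans[OF real_sqrt_ge_zero, of \<alpha> x] by (simp add: power_le_one)
        ultimately show "1 / x\<^sup>2 \<in> {1..1 / \<alpha>}"
          using \<alpha> less_le_trans[of 0 \<alpha> "x\<^sup>2"] by (auto simp: divide_simps)
      qed
    qed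
    show "(\<phi> has_real_derivative s \<theta> / (2 * cut_pt \<alpha> \<theta> * sqrt (cut_pt \<alpha> \<theta>))) (at \<theta> within {0..pi})" for \<theta>
      unfolding \<phi>_def using cut_pt_pos[of \<theta>]
      by (auto intro!: derivative_eq_intros cut_pt_deriv simp: s_def field_simps)
  qed simp
  moreover have "(s \<theta> / (2 * cut_pt \<alpha> \<theta> * sqrt (cut_pt \<alpha> \<theta>))) *\<^sub>R (\<phi> \<theta> ^ (2 * k - 1) * h (1 / (\<phi> \<theta>)\<^sup>2))
      = P \<theta> / (2 * real k)" for \<theta>
  proof -
    have pos: "sqrt (cut_pt \<alpha> \<theta>) > 0" "cut_pt \<alpha> \<theta> = (sqrt (cut_pt \<alpha> \<theta>))\<^sup>2" using cut_pt_pos[of \<theta>] by auto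
    have e: "(sqrt (cut_pt \<alpha> \<theta>)) ^ (2 * k - 1) * sqrt (cut_pt \<alpha> \<theta>) = cut_pt \<alpha> \<theta> ^ k"
      using k pos by (metis Suc_diff_1 mult.commute mult_pos_pos power_Suc power_mult zero_less_numeral less_le_trans zero_less_one)
    have "h (1 / (\<phi> \<theta>)\<^sup>2) = h (cut_pt \<alpha> \<theta>)" using pos by (simp add: \<phi>_def power_divide)
    then show ?thesis
      using e pos k cut_pt_pos[of \<theta>] unfolding P_def \<phi>_def by (simp add: power_divide field_simps)
  qed
  moreover have "\<phi> 0 = sqrt \<alpha>" "\<phi> pi = 1" using \<alpha> by (auto simp: \<phi>_def cut_pt_ends real_sqrt_divide)
  ultimately have I1: "((\<lambda>\<theta>. P \<theta> / (2 * real k)) has_integral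
      integral {sqrt \<alpha>..1} (\<lambda>\<tau>. \<tau> ^ (2 * k - 1) * h (1 / \<tau>\<^sup>2))) {0..pi}" by simp
  have I1: "(P has_integral
      2 * real k * integral {sqrt \<alpha>..1} (\<lambda>\<tau>. \<tau> ^ (2 * k - 1) * h (1 / \<tau>\<^sup>2))) {0..pi}"
    using has_integral_mult_right[OF I1, of "2 * real k"] k by simp
  \<comment> \<open>\<open>P - Q / \<surd>\<alpha>\<close> is the derivative of \<open>h t\<^sup>-\<^sup>k\<close> as a function of \<open>\<theta>\<close>, which is continuous up to the ends but
    need not be differentiable there.\<close>
  have I2: "((\<lambda>\<theta>. P \<theta> - Q \<theta> / sqrt \<alpha>) has_integral (h (cut_pt \<alpha> pi) / cut_pt \<alpha> pi ^ k - h (cut_pt \<alpha> 0) / cut_pt \<alpha> 0 ^ k)) {0..pi}"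
  proof (rule fundamental_theorem_of_calculus_interior)
    have "cut_pt \<alpha> a ^ k \<noteq> 0" for a using cut_pt_pos[of a] by simp
    then show "continuous_on {0..pi} (\<lambda>a. h (cut_pt \<alpha> a) / cut_pt \<alpha> a ^ k)"
      using cut_pt_in by (intro continuous_intros continuous_on_compose2[OF h]) auto
    fix \<theta> assume \<theta>: "\<theta> \<in> {0<..<pi}"
    have t: "1 < cut_pt \<alpha> \<theta>" "cut_pt \<alpha> \<theta> < 1 / \<alpha>" using cut_pt_in_open[of \<theta>] \<theta> by auto
    define q where "q = sqrt ((1 - \<alpha> * cut_pt \<alpha> \<theta>) * (cut_pt \<alpha> \<theta> - 1))"
    have q: "q = (1 - \<alpha>) * sin \<theta> / (2 * sqrt \<alpha>)" using sqrt_cut_pt[of \<theta>] \<theta> by (simp add: q_def)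
    have qpos: "q > 0" using \<theta> \<alpha> sin_gt_zero unfolding q by auto
    have sq: "s \<theta> = q / sqrt \<alpha>" unfolding q s_def using \<alpha> by (simp add: field_simps)
    have "((\<lambda>a. h (cut_pt \<alpha> a)) has_real_derivative S (cut_pt \<alpha> \<theta>) / (cut_pt \<alpha> \<theta> * q) * - s \<theta>) (at \<theta>)"
      unfolding s_def q_def by (rule DERIV_chain2[OF h'[OF t] cut_pt_deriv])
    then have "((\<lambda>a. h (cut_pt \<alpha> a) / cut_pt \<alpha> a ^ k) has_real_derivative
       ((S (cut_pt \<alpha> \<theta>) / (cut_pt \<alpha> \<theta> * q) * - s \<theta>) * cut_pt \<alpha> \<theta> ^ k - h (cut_pt \<alpha> \<theta>) * (real k * (cut_pt \<alpha> \<theta> ^ (k - Suc 0) * - s \<theta>))) / (cut_pt \<alpha> \<theta> ^ k * cut_pt \<alpha> \<theta> ^ k)) (at \<theta>)"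
      using t by (auto intro!: DERIV_divide derivative_eq_intros cut_pt_deriv simp: s_def)
    also have "((S (cut_pt \<alpha> \<theta>) / (cut_pt \<alpha> \<theta> * q) * - s \<theta>) * cut_pt \<alpha> \<theta> ^ k - h (cut_pt \<alpha> \<theta>) * (real k * (cut_pt \<alpha> \<theta> ^ (k - Suc 0) * - s \<theta>))) / (cut_pt \<alpha> \<theta> ^ k * cut_pt \<alpha> \<theta> ^ k)
      = P \<theta> - Q \<theta> / sqrt \<alpha>"
    proof -
      obtain n where n: "k = Suc n" using k by (cases k) auto
      have "((T / (t * q) * - (q / c)) * t ^ k - H * (real k * (t ^ (k - Suc 0) * - (q / c)))) / (t ^ k * t ^ k)
          = real k * (q / c) / t ^ Suc k * H - T / t ^ Suc k / c" if "t > 0" "c > 0" for T t c H :: real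
        using that qpos by (simp add: n field_simps)
      then show ?thesis
        using t \<alpha> unfolding P_def Q_def sq by simp
    qed
    finally show "((\<lambda>a. h (cut_pt \<alpha> a) / cut_pt \<alpha> a ^ k) has_vector_derivative P \<theta> - Q \<theta> / sqrt \<alpha>) (at \<theta>)"
      by (simp add: has_real_derivative_iff_has_vector_derivative)
  qed simp
  have I3: "((\<lambda>\<theta>. Q \<theta> / sqrt \<alpha>) has_integral (2 * real k * integral {sqrt \<alpha>..1} (\<lambda>\<tau>. \<tau> ^ (2 * k - 1) * h (1 / \<tau>\<^sup>2)) - (h 1 - \<alpha> ^ k * h (1 / \<alpha>)))) {0..pi}"
    using has_integral_diff[OF I1 I2] \<alpha> by (simp add: cut_pt_ends power_divide mult.commute)
  have "integral {0..pi} (\<lambda>\<theta>. Q \<theta> / sqrt \<alpha>) = pi * arcsine_mean \<alpha> (\<lambda>t. S t / t ^ Suc k)"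
    using \<alpha> unfolding arcsine_mean_def Q_def integral_divide by (simp add: divide_inverse)
  with I3 show ?thesis by (simp add: has_integral_iff)
qed

section \<open>Cauchy transforms of the arcsine law\<close>

lemma arcsine_mean_unique:
  "((\<lambda>\<theta>. g (cut_pt \<alpha> \<theta>)) has_integral I) {0..pi} \<Longrightarrow> arcsine_mean \<alpha> g = I /\<^sub>R (pi * sqrt \<alpha>)"
  by (simp add: arcsine_mean_def has_integral_iff)

lemma arcsine_mean_of_real:
  "(\<lambda>\<theta>. g (cut_pt \<alpha> \<theta>)) integrable_on {0..pi} \<Longrightarrow>
    arcsine_mean \<alpha> (\<lambda>t. of_real (g t) :: complex) = of_real (arcsine_mean \<alpha> g)"
  using has_integral_of_real[OF integrable_integral, of "\<lambda>\<theta>. g (cut_pt \<alpha> \<theta>)" "{0..pi}"]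
  by (subst arcsine_mean_unique) (auto simp: arcsine_mean_def scaleR_conv_of_real)

lemma cut_pt_integrable:
  fixes g :: "real \<Rightarrow> 'b::banach"
  assumes "continuous_on {1..1 / \<alpha>} g"
  shows "(\<lambda>\<theta>. g (cut_pt \<alpha> \<theta>)) integrable_on {0..pi}"
  using cut_pt_in
  by (intro integrable_continuous_real continuous_on_compose2[OF assms] continuous_on_cut_pt) auto

text \<open>Writing \<open>w\<close> as the image of \<open>\<rho>\<close> with \<open>|\<rho>| < 1\<close> under the Joukowski map of the cut,
  \<open>1 / (t(\<theta>) - w)\<close> becomes a multiple of the Poisson kernel. Squaring removes the choice of branch of
  the square root, which is fixed later by signs.\<close>

lemma cauchy_transform_squared:
  fixes w :: complex
  assumes w: "w \<notin> of_real ` {1..1 / \<alpha>}"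
  shows "(arcsine_mean \<alpha> (\<lambda>t. 1 / (of_real t - w)))\<^sup>2 * ((1 - of_real \<alpha> * w) * (1 - w)) = 1"
proof -
  define a where "a = complex_of_real \<alpha>"
  have a: "a \<noteq> 0" "1 - a \<noteq> 0" using \<alpha> by (auto simp: a_def)
  define v where "v = (2 * a * w - (1 + a)) / (1 - a)"
  have w_eq: "w = ((1 + a) + (1 - a) * v) / (2 * a)" using a by (simp add: v_def)
  have "v \<notin> of_real ` {-1..1}"
  proof
    assume "v \<in> of_real ` {-1..1}"
    then obtain x where x: "v = of_real x" "x \<in> {-1..1}" by auto
    have "w = of_real (cut_pt \<alpha> (arccos x))"
      using x by (simp add: w_eq cut_pt_def a_def cos_arccos)
    then show False using w cut_pt_in by blast
  qed
  then obtain \<rho> where \<rho>: "norm \<rho> < 1" "\<rho> \<noteq> 0" "2 * v * \<rho> = 1 + \<rho>\<^sup>2" by (rule joukowski_inverse)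
  have v: "v = (1 + \<rho>\<^sup>2) / (2 * \<rho>)" using \<rho> by (simp add: field_simps)
  have "norm (\<rho>\<^sup>2) < 1" using \<rho> by (simp add: norm_power power_less_one_iff)
  then have nz: "1 - \<rho>\<^sup>2 \<noteq> 0" by auto
  have "1 / (of_real (cut_pt \<alpha> \<theta>) - w) = - (4 * a * \<rho> / (1 - a)) * (1 / (1 - 2 * \<rho> * of_real (cos \<theta>) + \<rho>\<^sup>2))" for \<theta>
  proof -
    have "of_real (cut_pt \<alpha> \<theta>) - w = ((1 - a) / (2 * a)) * (of_real (cos \<theta>) - v)"
      using a by (simp add: w_eq cut_pt_def a_def[symmetric] field_simps)
    also have "of_real (cos \<theta>) - v = - (1 - 2 * \<rho> * of_real (cos \<theta>) + \<rho>\<^sup>2) / (2 * \<rho>)"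
      using \<rho>(2) by (simp add: v field_simps)
    finally have "1 / (of_real (cut_pt \<alpha> \<theta>) - w) =
        1 / ((1 - a) / (2 * a) * (- (1 - 2 * \<rho> * of_real (cos \<theta>) + \<rho>\<^sup>2) / (2 * \<rho>)))" by simp
    moreover have "1 / ((1 - a) / (2 * a) * (- x / (2 * \<rho>))) = - (4 * a * \<rho> / (1 - a)) * (1 / x)" for x
      by simp
    ultimately show ?thesis by (simp only:)
  qed
  then have "arcsine_mean \<alpha> (\<lambda>t. 1 / (of_real t - w)) =
      (- (4 * a * \<rho> / (1 - a)) * (of_real pi / (1 - \<rho>\<^sup>2))) /\<^sub>R (pi * sqrt \<alpha>)"
    by (intro arcsine_mean_unique)
      (simp only:, intro has_integral_mult_right has_integral_poisson_kernel \<rho>)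
  also have "\<dots> = - (4 * a * \<rho>) / ((1 - a) * (1 - \<rho>\<^sup>2) * of_real (sqrt \<alpha>))"
    using \<alpha> by (simp add: scaleR_conv_of_real field_simps)
  finally have J: "arcsine_mean \<alpha> (\<lambda>t. 1 / (of_real t - w)) = - (4 * a * \<rho>) / ((1 - a) * (1 - \<rho>\<^sup>2) * of_real (sqrt \<alpha>))" .
  have J2: "(- (4 * a * \<rho>) / ((1 - a) * (1 - \<rho>\<^sup>2) * of_real (sqrt \<alpha>)))\<^sup>2 = 16 * a * \<rho>\<^sup>2 / ((1 - a)\<^sup>2 * (1 - \<rho>\<^sup>2)\<^sup>2)"
  proof -
    have "(complex_of_real (sqrt \<alpha>))\<^sup>2 = a" using \<alpha> by (simp add: a_def flip: of_real_power)
    then show ?thesis using a by (simp add: power_divide power_mult_distrib power2_eq_square[of a])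
  qed
  have p: "(1 - of_real \<alpha> * w) * (1 - w) = (1 - a)\<^sup>2 * (v\<^sup>2 - 1) / (4 * a)"
    using a by (simp add: w_eq a_def[symmetric] field_simps power2_eq_square)
  have v2: "v\<^sup>2 - 1 = (1 - \<rho>\<^sup>2)\<^sup>2 / (4 * \<rho>\<^sup>2)"
    using \<rho>(2) by (simp add: v field_simps power2_eq_square)
  show ?thesis unfolding J J2 p v2 using a \<rho>(2) nz by simp
qed

text \<open>The end points are null sets. Rational functions that take a default value there, because numerator
  and denominator both vanish, can thus be replaced by their continuous extensions.\<close>

lemma arcsine_mean_cong:
  assumes "\<And>t. 1 < t \<Longrightarrow> t < 1 / \<alpha> \<Longrightarrow> f t = g t"
  shows "arcsine_mean \<alpha> f = arcsine_mean \<alpha> g"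
  unfolding arcsine_mean_def
  using assms cut_pt_in_open
  by (intro arg_cong[where f = "\<lambda>x. x /\<^sub>R _"] integral_spike[of "{0, pi}"]) auto

lemma cauchy_kernel_continuous:
  fixes w :: complex
  assumes "w \<notin> of_real ` {1..1 / \<alpha>}"
  shows "continuous_on {1..1 / \<alpha>} (\<lambda>t. 1 / (of_real t - w))"
  using assms by (intro continuous_intros) auto

text \<open>The Cauchy transform of a positive measure maps each open half-plane into its closure, which
  selects the branch of the square root at non-real points.\<close>

lemma Im_cauchy_transform:
  fixes w :: complex
  assumes "w \<notin> of_real ` {1..1 / \<alpha>}"
  shows "Im w * Im (arcsine_mean \<alpha> (\<lambda>t. 1 / (of_real t - w))) \<ge> 0"
proof -
  have "((\<lambda>\<theta>. 1 / (of_real (cut_pt \<alpha> \<theta>) - w)) has_integral integral {0..pi} (\<lambda>\<theta>. 1 / (of_real (cut_pt \<alpha> \<theta>) - w))) {0..pi}"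
    using cut_pt_integrable[OF cauchy_kernel_continuous[OF assms]] by (rule integrable_integral)
  from has_integral_linear[OF this bounded_linear_Im]
  have "((\<lambda>\<theta>. Im w * Im (1 / (of_real (cut_pt \<alpha> \<theta>) - w))) has_integral Im w * Im (integral {0..pi} (\<lambda>\<theta>. 1 / (of_real (cut_pt \<alpha> \<theta>) - w)))) {0..pi}"
    by (intro has_integral_mult_right) (simp add: o_def)
  then have "Im w * Im (integral {0..pi} (\<lambda>\<theta>. 1 / (of_real (cut_pt \<alpha> \<theta>) - w))) \<ge> 0"
    by (rule has_integral_nonneg) (auto simp: Im_divide intro!: divide_nonneg_nonneg)
  then have "0 \<le> inverse (pi * sqrt \<alpha>) * (Im w * Im (integral {0..pi} (\<lambda>\<theta>. 1 / (of_real (cut_pt \<alpha> \<theta>) - w))))"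
    by (rule mult_nonneg_nonneg[rotated]) (use \<alpha> in simp)
  then show ?thesis by (simp add: arcsine_mean_def mult.left_commute)
qed

lemma cauchy_transform_real:
  assumes "x < 1 \<or> 1 / \<alpha> < x"
  shows "arcsine_mean \<alpha> (\<lambda>t. 1 / (of_real t - of_real x :: complex)) =
      of_real ((if x < 1 then 1 else - 1) / sqrt ((1 - \<alpha> * x) * (1 - x)))"
proof -
  define j where "j = arcsine_mean \<alpha> (\<lambda>t. 1 / (t - x))"
  define p where "p = (1 - \<alpha> * x) * (1 - x)"
  have cont: "continuous_on {1..1 / \<alpha>} (\<lambda>t. 1 / (t - x))"
    using assms by (intro continuous_intros) auto
  have J: "arcsine_mean \<alpha> (\<lambda>t. 1 / (of_real t - of_real x :: complex)) = of_real j"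
    using arcsine_mean_of_real[OF cut_pt_integrable[OF cont]] by (simp add: j_def)
  have out: "complex_of_real x \<notin> of_real ` {1..1 / \<alpha>}" using assms by auto
  have "complex_of_real (j\<^sup>2 * p) = of_real 1"
    using cauchy_transform_squared[OF out] unfolding J p_def by simp
  then have jp: "j\<^sup>2 * p = 1" unfolding of_real_eq_iff .
  have "(if x < 1 then 1 else - 1) * j \<ge> 0"
  proof -
    have "integral {0..pi} (\<lambda>\<theta>. (if x < 1 then 1 else - 1) * (1 / (cut_pt \<alpha> \<theta> - x))) \<ge> 0"
    proof (intro integral_nonneg integrable_on_mult_right cut_pt_integrable[OF cont])
      show "0 \<le> (if x < 1 then 1 else - 1) * (1 / (cut_pt \<alpha> \<theta> - x))" for \<theta>
        using cut_pt_in[of \<theta>] assms by (auto intro: divide_nonneg_nonneg divide_nonpos_nonneg)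
    qed
    then have "0 \<le> inverse (pi * sqrt \<alpha>) * ((if x < 1 then 1 else - 1) * integral {0..pi} (\<lambda>\<theta>. 1 / (cut_pt \<alpha> \<theta> - x)))"
      unfolding integral_mult_right by (rule mult_nonneg_nonneg[rotated]) (use \<alpha> in simp)
    then show ?thesis unfolding j_def arcsine_mean_def by (simp only: real_scaleR_def mult.left_commute)
  qed
  moreover have "sqrt p = 1 / \<bar>j\<bar>"
  proof (rule real_sqrt_unique)
    have "j \<noteq> 0" using jp by auto
    then show "(1 / \<bar>j\<bar>)\<^sup>2 = p" using jp by (simp add: power_divide field_simps)
  qed simp
  ultimately show ?thesis unfolding J by (auto simp: p_def[symmetric] abs_if split: if_splits)
qed

text \<open>Pointwise \<open>a / ((t - w)(t - z)) = a / (z - w) (1 / (t - z) - 1 / (t - w))\<close>. A pole with vanishing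
  residue may lie on the cut; this happens for the Rayleigh cubic at \<open>\<alpha> = 1/2\<close>.\<close>

lemma cauchy_transform_partial_fractions:
  fixes z s :: complex and w a :: "'i \<Rightarrow> complex"
  assumes "finite I" and z: "z \<notin> of_real ` {1..1 / \<alpha>}"
    and wz: "\<And>i. i \<in> I \<Longrightarrow> w i \<noteq> z"
    and w: "\<And>i. i \<in> I \<Longrightarrow> a i \<noteq> 0 \<Longrightarrow> w i \<notin> of_real ` {1..1 / \<alpha>}"
  shows "arcsine_mean \<alpha> (\<lambda>t. (s + (\<Sum>i\<in>I. a i / (of_real t - w i))) / (of_real t - z)) =
    (s + (\<Sum>i\<in>I. a i / (z - w i))) * arcsine_mean \<alpha> (\<lambda>t. 1 / (of_real t - z)) -
    (\<Sum>i\<in>I. a i * arcsine_mean \<alpha> (\<lambda>t. 1 / (of_real t - w i)) / (z - w i))"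
proof -
  define K where "K = (\<lambda>w::complex. integral {0..pi} (\<lambda>\<theta>. 1 / (of_real (cut_pt \<alpha> \<theta>) - w)))"
  have K: "((\<lambda>\<theta>. 1 / (of_real (cut_pt \<alpha> \<theta>) - w)) has_integral K w) {0..pi}"
    if "w \<notin> of_real ` {1..1 / \<alpha>}" for w
    using cut_pt_integrable[OF cauchy_kernel_continuous[OF that]] by (simp add: K_def integrable_integral)
  have split: "(s + (\<Sum>i\<in>I. a i / (t - w i))) / (t - z) =
      (s + (\<Sum>i\<in>I. a i / (z - w i))) * (1 / (t - z)) - (\<Sum>i\<in>I. a i / (z - w i) * (1 / (t - w i)))"
    if t: "t \<in> of_real ` {1..1 / \<alpha>}" for t
  proof -
    have "a i / (t - w i) * (1 / (t - z)) = a i / (z - w i) * (1 / (t - z)) - a i / (z - w i) * (1 / (t - w i))"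
      if "i \<in> I" for i
    proof (cases "a i = 0")
      case False
      then have "t \<noteq> w i" "t \<noteq> z" using t z w[OF that False] by blast+
      then have "t - w i \<noteq> 0" "t - z \<noteq> 0" "z - w i \<noteq> 0" using wz[OF that] by auto
      then show ?thesis by (simp add: divide_simps) (simp add: algebra_simps)
    qed simp
    then have "(\<Sum>i\<in>I. a i / (t - w i)) * (1 / (t - z)) =
        (\<Sum>i\<in>I. a i / (z - w i)) * (1 / (t - z)) - (\<Sum>i\<in>I. a i / (z - w i) * (1 / (t - w i)))"
      unfolding sum_distrib_right sum_subtractf[symmetric] by (rule sum.cong[OF refl])
    then show ?thesis by (simp add: algebra_simps add_divide_distrib)
  qed
  have summand: "((\<lambda>\<theta>. a i / (z - w i) * (1 / (of_real (cut_pt \<alpha> \<theta>) - w i))) has_integral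
      a i / (z - w i) * K (w i)) {0..pi}" if "i \<in> I" for i
  proof (cases "a i = 0")
    case False
    then show ?thesis by (intro has_integral_mult_right K w[OF that])
  qed simp
  have "((\<lambda>\<theta>. (s + (\<Sum>i\<in>I. a i / (z - w i))) * (1 / (of_real (cut_pt \<alpha> \<theta>) - z)) -
      (\<Sum>i\<in>I. a i / (z - w i) * (1 / (of_real (cut_pt \<alpha> \<theta>) - w i)))) has_integral
      (s + (\<Sum>i\<in>I. a i / (z - w i))) * K z - (\<Sum>i\<in>I. a i / (z - w i) * K (w i))) {0..pi}"
    by (rule has_integral_diff[OF has_integral_mult_right[OF K[OF z]] has_integral_sum[OF \<open>finite I\<close> summand]])
  then have "((\<lambda>\<theta>. (s + (\<Sum>i\<in>I. a i / (of_real (cut_pt \<alpha> \<theta>) - w i))) / (of_real (cut_pt \<alpha> \<theta>) - z)) has_integral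
      (s + (\<Sum>i\<in>I. a i / (z - w i))) * K z - (\<Sum>i\<in>I. a i / (z - w i) * K (w i))) {0..pi}"
    using split cut_pt_in by simp
  from arcsine_mean_unique[OF this]
  have "arcsine_mean \<alpha> (\<lambda>t. (s + (\<Sum>i\<in>I. a i / (of_real t - w i))) / (of_real t - z)) =
      ((s + (\<Sum>i\<in>I. a i / (z - w i))) * K z - (\<Sum>i\<in>I. a i / (z - w i) * K (w i))) /\<^sub>R (pi * sqrt \<alpha>)" .
  moreover have "arcsine_mean \<alpha> (\<lambda>t. 1 / (of_real t - w)) = K w /\<^sub>R (pi * sqrt \<alpha>)" for w
    by (simp add: arcsine_mean_def K_def)
  ultimately show ?thesis
    by (simp add: scaleR_conv_of_real right_diff_distrib sum_distrib_left mult_ac)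
qed

text \<open>On the cut \<open>|z / t| < 1\<close>, and the geometric series of \<open>1 / (t - z)\<close> converges uniformly there.\<close>

lemma cauchy_transform_sums:
  fixes G :: "real \<Rightarrow> real"
  assumes G: "continuous_on {1..1 / \<alpha>} G" and z: "\<bar>z\<bar> < 1"
  shows "(\<lambda>n. arcsine_mean \<alpha> (\<lambda>t. G t / t ^ Suc n) * z ^ n) sums arcsine_mean \<alpha> (\<lambda>t. G t / (t - z))"
proof -
  let ?g = "\<lambda>n t. G t / t ^ Suc n * z ^ n"
  have "bounded (G ` {1..1 / \<alpha>})"
    using G by (intro compact_imp_bounded compact_continuous_image) auto
  then obtain B where B: "\<And>t. t \<in> {1..1 / \<alpha>} \<Longrightarrow> norm (G t) \<le> B"
    unfolding bounded_iff by blast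
  have sums: "(\<lambda>n. ?g n t) sums (G t / (t - z))" if t: "t \<in> {1..1 / \<alpha>}" for t
  proof -
    have "\<bar>z\<bar> < t" using t z by simp
    then have "norm (z / t) < 1" using t by simp
    from sums_mult[OF geometric_sums[OF this], of "G t / t"]
    show ?thesis using t \<open>\<bar>z\<bar> < t\<close> by (simp add: power_divide field_simps)
  qed
  have cont: "continuous_on {0..pi} (\<lambda>\<theta>. ?g n (cut_pt \<alpha> \<theta>))" for n
  proof -
    have "cut_pt \<alpha> \<theta> ^ Suc n \<noteq> 0" for \<theta> using cut_pt_pos[of \<theta>] by simp
    then show ?thesis using cut_pt_in
      by (intro continuous_intros continuous_on_compose2[OF G] continuous_on_cut_pt) auto
  qed
  have lim: "uniform_limit {0..pi} (\<lambda>N \<theta>. \<Sum>n<N. ?g n (cut_pt \<alpha> \<theta>)) (\<lambda>\<theta>. \<Sum>n. ?g n (cut_pt \<alpha> \<theta>)) sequentially"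
  proof (rule Weierstrass_m_test)
    show "summable (\<lambda>n. B * \<bar>z\<bar> ^ n)" using z by (intro summable_mult summable_geometric) simp
    fix n \<theta>
    have "1 \<le> cut_pt \<alpha> \<theta> ^ Suc n" using cut_pt_pos(1)[of \<theta>] by (rule one_le_power)
    then have "norm (G (cut_pt \<alpha> \<theta>)) / cut_pt \<alpha> \<theta> ^ Suc n \<le> B / 1"
      using B[OF cut_pt_in, of \<theta>] by (intro frac_le) auto
    then have "norm (G (cut_pt \<alpha> \<theta>)) / cut_pt \<alpha> \<theta> ^ Suc n * \<bar>z\<bar> ^ n \<le> B * \<bar>z\<bar> ^ n"
      by (intro mult_right_mono) auto
    then show "norm (?g n (cut_pt \<alpha> \<theta>)) \<le> B * \<bar>z\<bar> ^ n"
      using cut_pt_pos(2)[of \<theta>] by (simp add: norm_mult power_abs abs_mult)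
  qed
  have cont_sum: "continuous_on {0..pi} (\<lambda>\<theta>. \<Sum>n<N. ?g n (cut_pt \<alpha> \<theta>))" for N
    by (intro continuous_on_sum cont)
  obtain I J where IJ: "\<And>N. ((\<lambda>\<theta>. \<Sum>n<N. ?g n (cut_pt \<alpha> \<theta>)) has_integral I N) {0..pi}"
    "((\<lambda>\<theta>. \<Sum>n. ?g n (cut_pt \<alpha> \<theta>)) has_integral J) {0..pi}" "I \<longlonglongrightarrow> J"
    by (rule uniform_limit_integral_cbox[where a = 0 and b = pi, unfolded box_real, OF lim cont_sum sequentially_bot])
      (rule that)
  have "(\<lambda>\<theta>. \<Sum>n. ?g n (cut_pt \<alpha> \<theta>)) = (\<lambda>\<theta>. G (cut_pt \<alpha> \<theta>) / (cut_pt \<alpha> \<theta> - z))"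
    using sums[OF cut_pt_in] by (simp add: sums_iff)
  with IJ(2) have J: "arcsine_mean \<alpha> (\<lambda>t. G t / (t - z)) = J /\<^sub>R (pi * sqrt \<alpha>)"
    by (intro arcsine_mean_unique) simp
  have "((\<lambda>\<theta>. \<Sum>n<N. ?g n (cut_pt \<alpha> \<theta>)) has_integral (\<Sum>n<N. integral {0..pi} (\<lambda>\<theta>. ?g n (cut_pt \<alpha> \<theta>)))) {0..pi}" for N
    using cont by (intro has_integral_sum integrable_integral integrable_continuous_real) auto
  then have I: "I N = (\<Sum>n<N. integral {0..pi} (\<lambda>\<theta>. ?g n (cut_pt \<alpha> \<theta>)))" for N
    using IJ(1) has_integral_unique by blast
  have "(\<lambda>n. integral {0..pi} (\<lambda>\<theta>. ?g n (cut_pt \<alpha> \<theta>))) sums J"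
    using IJ(3) by (simp add: sums_def I[abs_def])
  from sums_mult[OF this, of "inverse (pi * sqrt \<alpha>)"]
  show ?thesis unfolding J
    unfolding arcsine_mean_def integral_mult_left real_scaleR_def by (simp only: mult.assoc)
qed

section \<open>The Dirichlet coefficient\<close>

text \<open>The differentiated function is \<open>2 S / \<surd>p\<close> with \<open>S(t) = 1 + (c/2) / (t - c)\<close>. Since \<open>p(c) = 1\<close> and \<open>c\<close>
  lies to the right of the cut, \<open>J(c) = -1\<close>, and the pole contributes the geometric series of
  \<open>c / (c - z)\<close>.\<close>

lemma dirichlet_mean_deriv:
  fixes k :: nat
  defines "c \<equiv> (\<alpha> + 1) / \<alpha>"
  shows "(deriv ^^ k) (\<lambda>t. (2 * t - c) / (t - c) * (1 / sqrt ((1 - \<alpha> * t) * (1 - t)))) 0 =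
    fact k * (2 * arcsine_mean \<alpha> (\<lambda>t. (1 + c / 2 / (t - c)) / t ^ Suc k) + (1 / c) ^ k)"
proof (rule higher_deriv_at_0_of_sums[where R = 1])
  have c: "1 / \<alpha> < c" "1 < c" "(1 - \<alpha> * c) * (1 - c) = 1"
    using \<alpha> by (auto simp: c_def field_simps)
  define G where "G = (\<lambda>t. 1 + c / 2 / (t - c))"
  have G: "continuous_on {1..1 / \<alpha>} G" unfolding G_def using c by (intro continuous_intros) auto
  fix z :: real assume z: "\<bar>z\<bar> < 1"
  then have z1: "z < 1" "z \<noteq> c" "z < c" "\<bar>z\<bar> < c" using c by auto
  define J where "J = (\<lambda>w::complex. arcsine_mean \<alpha> (\<lambda>t. 1 / (of_real t - w)))"
  define r where "r = 1 / sqrt ((1 - \<alpha> * z) * (1 - z))"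
  have Jz: "J (of_real z) = of_real r"
    using cauchy_transform_real[of z] z1 unfolding J_def r_def by simp
  have Jc: "J (of_real c) = - 1"
    using cauchy_transform_real[of c] c unfolding J_def by simp
  have out: "complex_of_real z \<notin> of_real ` {1..1 / \<alpha>}" "complex_of_real c \<notin> of_real ` {1..1 / \<alpha>}"
    using z1 c by auto
  have cont: "continuous_on {1..1 / \<alpha>} (\<lambda>t. G t / (t - z))"
    using z1 by (intro continuous_intros G) auto
  have "complex_of_real (arcsine_mean \<alpha> (\<lambda>t. G t / (t - z))) =
      arcsine_mean \<alpha> (\<lambda>t. (1 + (\<Sum>i\<in>{()}. of_real (c / 2) / (of_real t - of_real c))) / (of_real t - of_real z))"
    unfolding arcsine_mean_of_real[OF cut_pt_integrable[OF cont], symmetric] by (simp add: G_def)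
  also have "\<dots> = (1 + (\<Sum>i\<in>{()}. of_real (c / 2) / (of_real z - of_real c))) * J (of_real z) -
    (\<Sum>i\<in>{()}. of_real (c / 2) * J (of_real c) / (of_real z - of_real c))"
    unfolding J_def by (rule cauchy_transform_partial_fractions) (use out z1 in auto)
  also have "\<dots> = complex_of_real (G z * r + c / 2 / (z - c))"
    unfolding Jz Jc G_def by simp
  finally have K: "arcsine_mean \<alpha> (\<lambda>t. G t / (t - z)) = G z * r + c / 2 / (z - c)"
    unfolding of_real_eq_iff .
  have "(\<lambda>n. 2 * (arcsine_mean \<alpha> (\<lambda>t. G t / t ^ Suc n) * z ^ n) + (1 / c) ^ n * z ^ n) sums
      (2 * (G z * r + c / 2 / (z - c)) + c / (c - z))"
    using cauchy_transform_sums[OF G z] z1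
    by (intro sums_add sums_mult geometric_sums_shifted) (auto simp: K)
  also have "2 * (G z * r + c / 2 / (z - c)) + c / (c - z) = (2 * z - c) / (z - c) * r"
    using z1 unfolding G_def by (simp add: divide_simps) (simp add: algebra_simps)
  finally show "(\<lambda>n. (2 * arcsine_mean \<alpha> (\<lambda>t. (1 + c / 2 / (t - c)) / t ^ Suc n) + (1 / c) ^ n) * z ^ n) sums
      ((2 * z - c) / (z - c) * (1 / sqrt ((1 - \<alpha> * z) * (1 - z))))"
    by (simp add: G_def r_def algebra_simps)
qed simp

text \<open>The angle vanishes at both ends of the cut, so there are no boundary terms. Its derivative is
  rational apart from the square root because \<open>1 + (1 - \<alpha> t)(t - 1) = t (1 + \<alpha> - \<alpha> t)\<close>.\<close>

lemma dirichlet_integral: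
  assumes "k \<ge> 1"
  defines "c \<equiv> (\<alpha> + 1) / \<alpha>"
  shows "2 * real k * integral {sqrt \<alpha>..1} (\<lambda>\<tau>. \<tau> ^ (2 * k - 1) * arctan (sqrt ((1 - \<alpha> / \<tau>\<^sup>2) * (1 / \<tau>\<^sup>2 - 1)))) =
    pi * arcsine_mean \<alpha> (\<lambda>t. (1 + c / 2 / (t - c)) / t ^ Suc k)"
proof -
  define h where "h = (\<lambda>t. arctan (sqrt ((1 - \<alpha> * t) * (t - 1))))"
  have "2 * real k * integral {sqrt \<alpha>..1} (\<lambda>\<tau>. \<tau> ^ (2 * k - 1) * h (1 / \<tau>\<^sup>2)) =
    h 1 - \<alpha> ^ k * h (1 / \<alpha>) + pi * arcsine_mean \<alpha> (\<lambda>t. (1 + c / 2 / (t - c)) / t ^ Suc k)"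
  proof (rule power_integral_by_parts[OF assms(1)])
    show "continuous_on {1..1 / \<alpha>} h" unfolding h_def by (intro continuous_intros)
    fix t assume t: "1 < t" "t < 1 / \<alpha>"
    define q where "q = sqrt ((1 - \<alpha> * t) * (t - 1))"
    have p: "(1 - \<alpha> * t) * (t - 1) > 0" using t \<alpha> by (intro mult_pos_pos) (auto simp: field_simps)
    then have q: "q > 0" "q\<^sup>2 = (1 - \<alpha> * t) * (t - 1)" by (auto simp: q_def)
    have "(h has_real_derivative (inverse (1 + q\<^sup>2) * (inverse q / 2 * (- \<alpha> * (t - 1) + (1 - \<alpha> * t))))) (at t)"
      unfolding h_def q_def using p by (auto intro!: derivative_eq_intros)
    also have "inverse (1 + q\<^sup>2) * (inverse q / 2 * (- \<alpha> * (t - 1) + (1 - \<alpha> * t))) =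
      (1 + c / 2 / (t - c)) / (t * q)"
    proof -
      have "\<alpha> * t < 1" using t \<alpha> by (simp add: field_simps)
      then have n: "1 + \<alpha> - \<alpha> * t > 0" using \<alpha> by simp
      have e1: "1 + q\<^sup>2 = t * (1 + \<alpha> - \<alpha> * t)" unfolding q(2) by (simp add: algebra_simps)
      have e2: "1 + c / 2 / (t - c) = (1 + \<alpha> - 2 * \<alpha> * t) / (2 * (1 + \<alpha> - \<alpha> * t))"
      proof -
        have tc: "t - c = - (1 + \<alpha> - \<alpha> * t) / \<alpha>" using \<alpha> by (simp add: c_def field_simps)
        have "x / 2 / (- y / a) = - (x * a) / (2 * y)" for x y a :: real by simp
        then have "c / 2 / (t - c) = - (c * \<alpha>) / (2 * (1 + \<alpha> - \<alpha> * t))"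
          unfolding tc .
        also have "c * \<alpha> = 1 + \<alpha>" using \<alpha> by (simp add: c_def)
        finally have e: "c / 2 / (t - c) = - (1 + \<alpha>) / (2 * (1 + \<alpha> - \<alpha> * t))" .
        show ?thesis unfolding e using n by (simp add: divide_simps)
      qed
      show ?thesis unfolding e1 e2 using n q(1) t by (simp add: divide_simps) (simp add: algebra_simps)
    qed
    finally show "(h has_real_derivative (1 + c / 2 / (t - c)) / (t * sqrt ((1 - \<alpha> * t) * (t - 1)))) (at t)"
      by (simp add: q_def)
  qed
  then show ?thesis using \<alpha> by (simp add: h_def)
qed

section \<open>Cauchy transform at the roots of the Rayleigh cubic\<close>

lemma rayleigh_root:
  "0 < rayleigh_root \<alpha>" "rayleigh_root \<alpha> < 1" "rayleigh_cubic \<alpha> (rayleigh_root \<alpha>) = 0"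
  "0 < x \<Longrightarrow> x < 1 \<Longrightarrow> rayleigh_cubic \<alpha> x = 0 \<Longrightarrow> x = rayleigh_root \<alpha>"
  using theI'[OF rayleigh_root_ex1[OF \<alpha>]] rayleigh_root_ex1[OF \<alpha>]
  unfolding rayleigh_root_def[symmetric] by blast+

text \<open>This factorises \<open>t C(t)\<close> as the sum of squares of the two arguments \<open>(t - 2)\<^sup>2\<close> and
  \<open>4 \<surd>((1 - \<alpha> t)(t - 1))\<close> of the angle. It explains both why the cubic is the denominator of the
  derivative of the angle and why \<open>16 p(w) = (w - 2)\<^sup>4\<close> at its roots.\<close>

lemma rayleigh_cubic_quartic:
  "t * rayleigh_cubic \<alpha> t = (t - 2) ^ 4 + 16 * ((1 - \<alpha> * t) * (t - 1))"
  by (simp add: rayleigh_cubic_def algebra_simps power2_eq_square power3_eq_cube power4_eq_xxxx)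

lemma rayleigh_cubic_pos:
  assumes "1 < t" "t < 1 / \<alpha>"
  shows "rayleigh_cubic \<alpha> t > 0"
proof -
  have "(1 - \<alpha> * t) * (t - 1) > 0" using assms \<alpha> by (intro mult_pos_pos) (auto simp: field_simps)
  moreover have "(t - 2) ^ 4 \<ge> 0" by simp
  ultimately have "t * rayleigh_cubic \<alpha> t > 0" unfolding rayleigh_cubic_quartic by linarith
  then show ?thesis using assms by (simp add: zero_less_mult_iff)
qed

lemma rayleigh_residue_inner:
  "of_real (rayleigh_root \<alpha> * (rayleigh_root \<alpha> - 2)\<^sup>2 / 16) *
    arcsine_mean \<alpha> (\<lambda>t. 1 / (of_real t - of_real (rayleigh_root \<alpha>))) = (of_real (rayleigh_root \<alpha> / 4) :: complex)"
proof -
  define w where "w = rayleigh_root \<alpha>"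
  have w: "0 < w" "w < 1" "rayleigh_cubic \<alpha> w = 0" using rayleigh_root(1-3) unfolding w_def by auto
  have sq: "sqrt ((1 - \<alpha> * w) * (1 - w)) = (w - 2)\<^sup>2 / 4"
  proof (rule real_sqrt_unique)
    have "(w - 2) ^ 4 = 16 * ((1 - \<alpha> * w) * (1 - w))"
      using rayleigh_cubic_quartic[of w] unfolding w(3) by (simp add: algebra_simps)
    then show "((w - 2)\<^sup>2 / 4)\<^sup>2 = (1 - \<alpha> * w) * (1 - w)" by (simp add: power_divide)
  qed simp
  have "arcsine_mean \<alpha> (\<lambda>t. 1 / (of_real t - of_real w)) = complex_of_real (1 / ((w - 2)\<^sup>2 / 4))"
    using cauchy_transform_real[of w] w unfolding sq by simp
  moreover have "w * (w - 2)\<^sup>2 / 16 * (1 / ((w - 2)\<^sup>2 / 4)) = w / 4" using w by simp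
  ultimately show ?thesis unfolding w_def[symmetric] by (simp only: of_real_mult[symmetric])
qed

text \<open>The pair \<open>u\<close>, \<open>v\<close> consists of the two roots other than \<open>w\<close>. From \<open>J(u)\<^sup>2 p(u) = 1\<close> and
  \<open>16 p(u) = (u - 2)\<^sup>4\<close> one gets \<open>J(u) = \<plusminus>4 / (u - 2)\<^sup>2\<close>. A real \<open>u\<close> lies to the right of the cut, where \<open>J\<close>
  is negative. For non-real \<open>u\<close> the roots are conjugate with real part \<open>(8 - w) / 2 > 2\<close>, so
  \<open>4 / (u - 2)\<^sup>2\<close> has its imaginary part of the sign opposite to that of \<open>u\<close> and cannot be a value of \<open>J\<close>.
  The excluded value \<open>2\<close> is a root only if it is an end point of the cut, and its residue is then zero.\<close>

lemma rayleigh_residue_outer: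
  fixes u v :: complex
  defines "w \<equiv> rayleigh_root \<alpha>"
  assumes sum: "u + v = of_real (8 - w)" and prod: "u * v = of_real (24 - 16 * \<alpha> - w * (8 - w))"
    and u2: "u \<noteq> 2"
  shows "u \<notin> of_real ` {1..1 / \<alpha>}"
    and "u * (u - 2)\<^sup>2 / 16 * arcsine_mean \<alpha> (\<lambda>t. 1 / (of_real t - u)) = - (u / 4)"
proof -
  have w: "0 < w" "w < 1" "rayleigh_cubic \<alpha> w = 0" using rayleigh_root(1-3) unfolding w_def by auto
  have v: "v = of_real (8 - w) - u" using sum by (simp add: algebra_simps)
  have w3: "of_real w ^ 3 - 8 * (of_real w)\<^sup>2 + 8 * (3 - 2 * of_real \<alpha>) * of_real w + 16 * (of_real \<alpha> - 1) = (0::complex)"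
    using arg_cong[OF w(3)[unfolded rayleigh_cubic_def], of complex_of_real] by simp
  have quad: "u * (of_real (8 - w) - u) = of_real (24 - 16 * \<alpha> - w * (8 - w))"
    using prod unfolding v .
  have cubic: "u ^ 3 - 8 * u\<^sup>2 + 8 * (3 - 2 * of_real \<alpha>) * u + 16 * (of_real \<alpha> - 1) = 0"
  proof -
    have "u ^ 3 - 8 * u\<^sup>2 + 8 * (3 - 2 * of_real \<alpha>) * u + 16 * (of_real \<alpha> - 1) =
        (of_real w ^ 3 - 8 * (of_real w)\<^sup>2 + 8 * (3 - 2 * of_real \<alpha>) * of_real w + 16 * (of_real \<alpha> - 1)) -
        (u - of_real w) * (u * (of_real (8 - w) - u) - of_real (24 - 16 * \<alpha> - w * (8 - w)))"
      by (simp add: algebra_simps power2_eq_square power3_eq_cube)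
    then show ?thesis unfolding w3 quad by simp
  qed
  have quartic: "16 * ((1 - of_real \<alpha> * u) * (1 - u)) = (u - 2) ^ 4"
  proof -
    have "(u - 2) ^ 4 - 16 * ((1 - of_real \<alpha> * u) * (1 - u)) =
      u * (u ^ 3 - 8 * u\<^sup>2 + 8 * (3 - 2 * of_real \<alpha>) * u + 16 * (of_real \<alpha> - 1))"
      by (simp add: algebra_simps power2_eq_square power3_eq_cube power4_eq_xxxx)
    then show ?thesis unfolding cubic by simp
  qed
  have cubic_real: "rayleigh_cubic \<alpha> x = 0" if "u = of_real x" for x
  proof -
    have "complex_of_real (rayleigh_cubic \<alpha> x) = 0"
      using cubic unfolding that rayleigh_cubic_def by simp
    then show ?thesis by simp
  qed
  show out: "u \<notin> of_real ` {1..1 / \<alpha>}"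
  proof
    assume "u \<in> of_real ` {1..1 / \<alpha>}"
    then obtain x where x: "u = of_real x" "1 \<le> x" "x \<le> 1 / \<alpha>" by auto
    have "(1 - \<alpha> * x) * (x - 1) \<ge> 0" using x \<alpha> by (intro mult_nonneg_nonneg) (auto simp: field_simps)
    moreover have "(x - 2) ^ 4 \<ge> 0" by simp
    moreover have "(x - 2) ^ 4 + 16 * ((1 - \<alpha> * x) * (x - 1)) = 0"
      using rayleigh_cubic_quartic[of x] cubic_real[OF x(1)] by simp
    ultimately have "(x - 2) ^ 4 = 0" by linarith
    then show False using x u2 by simp
  qed
  define J where "J = arcsine_mean \<alpha> (\<lambda>t. 1 / (of_real t - u))"
  have "(J * (u - 2)\<^sup>2)\<^sup>2 = 16 * (J\<^sup>2 * ((1 - of_real \<alpha> * u) * (1 - u)))"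
    using quartic by (simp add: power_mult_distrib)
  also have "\<dots> = 4\<^sup>2" using cauchy_transform_squared[OF out] by (simp add: J_def)
  finally have "J * (u - 2)\<^sup>2 = 4 \<or> J * (u - 2)\<^sup>2 = - 4" unfolding power2_eq_iff .
  moreover have "J * (u - 2)\<^sup>2 \<noteq> 4"
  proof (cases "Im u = 0")
    case True
    define x where "x = Re u"
    have x: "u = of_real x" using True by (simp add: x_def complex_eq_iff)
    have "x \<ge> 1"
    proof (rule ccontr)
      assume "\<not> x \<ge> 1"
      have "x > 0"
      proof (rule ccontr)
        assume "\<not> x > 0"
        then have "x ^ 3 \<le> 0" "8 * (3 - 2 * \<alpha>) * x \<le> 0" "16 * (\<alpha> - 1) < 0" "8 * x\<^sup>2 \<ge> 0"
          using \<alpha> by (auto simp: power3_eq_cube mult_nonneg_nonpos mult_nonpos_nonpos)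
        then have "rayleigh_cubic \<alpha> x < 0" unfolding rayleigh_cubic_def by linarith
        then show False using cubic_real[OF x] by simp
      qed
      then have "x = w" unfolding w_def using rayleigh_root(4) cubic_real[OF x] \<open>\<not> x \<ge> 1\<close> by simp
      have "complex_of_real (w * (8 - w - w)) = of_real (24 - 16 * \<alpha> - w * (8 - w))"
        using quad unfolding x \<open>x = w\<close> by simp
      then have "w * (8 - w - w) = 24 - 16 * \<alpha> - w * (8 - w)" unfolding of_real_eq_iff .
      \<comment> \<open>A double root in \<open>(0, 1)\<close>: eliminating \<open>\<alpha>\<close> leaves a polynomial in \<open>w\<close> that is negative there.\<close>
      then have \<alpha>16: "16 * \<alpha> = 24 - 16 * w + 3 * w\<^sup>2"
        by (simp add: algebra_simps power2_eq_square)
      have "w ^ 3 - 8 * w\<^sup>2 + 24 * w - w * (16 * \<alpha>) + 16 * \<alpha> - 16 = 0"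
        using w(3) by (simp add: rayleigh_cubic_def algebra_simps)
      then have "- 1 - 5 * (1 - w)\<^sup>2 - 2 * (1 - w) ^ 3 = 0"
        unfolding \<alpha>16 by (simp add: algebra_simps power2_eq_square power3_eq_cube)
      moreover have "(1 - w) ^ 3 \<ge> 0" "(1 - w)\<^sup>2 \<ge> 0" using w by auto
      ultimately show False by linarith
    qed
    then have "x > 1 / \<alpha>" using out x by (auto simp: not_le)
    moreover have "x > 1" using \<open>x \<ge> 1\<close> out x \<alpha> by (cases "x = 1") auto
    ultimately have "J = of_real (- 1 / sqrt ((1 - \<alpha> * x) * (1 - x)))"
      using cauchy_transform_real[of x] unfolding J_def x by simp
    then have "J * (u - 2)\<^sup>2 = of_real (- (1 / sqrt ((1 - \<alpha> * x) * (1 - x)) * (x - 2)\<^sup>2))"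
      unfolding x by simp
    moreover have "- (1 / sqrt ((1 - \<alpha> * x) * (1 - x)) * (x - 2)\<^sup>2) \<le> 0"
    proof -
      have "(1 - \<alpha> * x) * (1 - x) \<ge> 0"
        using \<open>x > 1\<close> \<open>x > 1 / \<alpha>\<close> \<alpha> by (intro mult_nonpos_nonpos) (auto simp: field_simps)
      then show ?thesis by simp
    qed
    ultimately show ?thesis by (metis of_real_eq_iff of_real_numeral not_numeral_le_zero)
  next
    case False
    have "Im (u * (of_real (8 - w) - u)) = 0" unfolding quad by simp
    then have "Im u * (8 - w - 2 * Re u) = 0" by (simp add: algebra_simps)
    then have re: "Re u > 2" using False w by auto
    show ?thesis
    proof
      assume J4: "J * (u - 2)\<^sup>2 = 4"
      define s where "s = (u - 2)\<^sup>2"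
      have "J = 4 / s" using J4 u2 unfolding s_def by (simp add: field_simps)
      then have "Im J = - (4 * Im s / ((Re s)\<^sup>2 + (Im s)\<^sup>2))" by (simp add: Im_divide)
      moreover have ims: "Im s = 2 * Im u * (Re u - 2)" by (simp add: s_def power2_eq_square)
      ultimately have "Im u * Im J = - (8 * (Im u)\<^sup>2 * (Re u - 2) / ((Re s)\<^sup>2 + (Im s)\<^sup>2))"
        by (simp add: power2_eq_square)
      moreover have "8 * (Im u)\<^sup>2 * (Re u - 2) / ((Re s)\<^sup>2 + (Im s)\<^sup>2) > 0"
        using False re ims by (intro divide_pos_pos mult_pos_pos add_nonneg_pos) auto
      moreover have "Im u * Im J \<ge> 0" using Im_cauchy_transform[OF out] by (simp add: J_def)
      ultimately show False by linarith
    qed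
  qed
  ultimately have "J * (u - 2)\<^sup>2 = - 4" by blast
  then have "u * (J * (u - 2)\<^sup>2) / 16 = - (u / 4)" by simp
  then show "u * (u - 2)\<^sup>2 / 16 * arcsine_mean \<alpha> (\<lambda>t. 1 / (of_real t - u)) = - (u / 4)"
    by (simp add: J_def mult_ac)
qed

section \<open>The free boundary coefficient\<close>

text \<open>With \<open>q = (1 - \<alpha> t)(t - 1)\<close>, the numerator of the derivative is a multiple of \<open>4 q - (t - 2) q'\<close>, which is
  \<open>-P\<close>, and the denominator is the sum of squares \<open>t C(t)\<close>.\<close>

lemma rayleigh_angle_deriv:
  assumes t: "1 < t" "t < 1 / \<alpha>"
  shows "((\<lambda>t. arctan ((t - 2)\<^sup>2 / (4 * sqrt ((1 - \<alpha> * t) * (t - 1))))) has_real_derivative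
    - 2 * ((t - 2) * rayleigh_numerator \<alpha> t / rayleigh_cubic \<alpha> t) / (t * sqrt ((1 - \<alpha> * t) * (t - 1)))) (at t)"
proof -
  define s where "s = sqrt ((1 - \<alpha> * t) * (t - 1))"
  define q' where "q' = - \<alpha> * (t - 1) + (1 - \<alpha> * t)"
  define C where "C = rayleigh_cubic \<alpha> t"
  have p: "(1 - \<alpha> * t) * (t - 1) > 0" using t \<alpha> by (intro mult_pos_pos) (auto simp: field_simps)
  then have s: "s > 0" "s\<^sup>2 = (1 - \<alpha> * t) * (t - 1)" by (auto simp: s_def)
  have C: "C > 0" "t * C = (t - 2) ^ 4 + 16 * s\<^sup>2"
    using rayleigh_cubic_pos[OF t] rayleigh_cubic_quartic[of t] by (auto simp: C_def s(2))
  have "((\<lambda>t. arctan ((t - 2)\<^sup>2 / (4 * sqrt ((1 - \<alpha> * t) * (t - 1))))) has_real_derivative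
    inverse (1 + ((t - 2)\<^sup>2 / (4 * s))\<^sup>2) * ((2 * (t - 2) * (4 * s) - (t - 2)\<^sup>2 * (4 * (inverse s / 2 * q'))) / (4 * s * (4 * s)))) (at t)"
    using p unfolding s_def q'_def by (auto intro!: derivative_eq_intros)
  also have "1 + ((t - 2)\<^sup>2 / (4 * s))\<^sup>2 = t * C / (16 * s\<^sup>2)"
    unfolding C(2) using s(1) by (simp add: power_divide power_mult_distrib field_simps)
  also have "2 * (t - 2) * (4 * s) - (t - 2)\<^sup>2 * (4 * (inverse s / 2 * q')) =
      2 * (t - 2) * (4 * s\<^sup>2 - (t - 2) * q') / s"
    using s(1) by (simp add: field_simps power2_eq_square)
  also have "4 * s\<^sup>2 - (t - 2) * q' = - rayleigh_numerator \<alpha> t"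
    unfolding s(2) q'_def rayleigh_numerator_def by (simp add: algebra_simps power2_eq_square)
  also have "inverse (t * C / (16 * s\<^sup>2)) * (2 * (t - 2) * (- rayleigh_numerator \<alpha> t) / s / (4 * s * (4 * s))) =
      - 2 * ((t - 2) * rayleigh_numerator \<alpha> t / C) / (t * s)"
    using s(1) C(1) t by (simp add: divide_simps power2_eq_square)
  finally show ?thesis by (simp only: s_def C_def)
qed

text \<open>The angle extends continuously to the end points of the cut, where the square root vanishes: to
  \<open>\<pi>/2\<close> as long as \<open>(t - 2)\<^sup>2\<close> stays positive. The exception is \<open>t = 1/\<alpha> = 2\<close>, where \<open>(t - 2)\<^sup>2\<close> vanishes
  faster than the root and the limit is \<open>0\<close>. In the half-angle formula a common factor \<open>\<surd>(2 - t)\<close>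
  has to be cancelled in that case.\<close>

lemma rayleigh_angle_extension:
  obtains h where "continuous_on {1..1 / \<alpha>} h"
    "h 1 = pi / 2" "h (1 / \<alpha>) = (if \<alpha> = 1 / 2 then 0 else pi / 2)"
    "\<And>t. 1 < t \<Longrightarrow> t < 1 / \<alpha> \<Longrightarrow> h t = arctan ((t - 2)\<^sup>2 / (4 * sqrt ((1 - \<alpha> * t) * (t - 1))))"
proof (cases "\<alpha> = 1 / 2")
  case False
  define x where "x = (\<lambda>t. 4 * sqrt ((1 - \<alpha> * t) * (t - 1)))"
  define h where "h = (\<lambda>t. 2 * arctan ((t - 2)\<^sup>2 / (x t + sqrt ((x t)\<^sup>2 + ((t - 2)\<^sup>2)\<^sup>2))))"
  have ends: "h t = pi / 2" if "x t = 0" "t \<noteq> 2" for t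
  proof -
    have "sqrt (0\<^sup>2 + ((t - 2)\<^sup>2)\<^sup>2) = (t - 2)\<^sup>2" by (rule real_sqrt_unique) auto
    then show ?thesis unfolding h_def that(1) using that(2) by (simp add: arctan_one)
  qed
  have pos: "x t + sqrt ((x t)\<^sup>2 + ((t - 2)\<^sup>2)\<^sup>2) > 0" if t: "t \<in> {1..1 / \<alpha>}" for t
  proof -
    have q: "(1 - \<alpha> * t) * (t - 1) \<ge> 0" using t \<alpha> by (intro mult_nonneg_nonneg) (auto simp: field_simps)
    then have "x t \<ge> 0" by (simp add: x_def)
    moreover have "(x t)\<^sup>2 + ((t - 2)\<^sup>2)\<^sup>2 > 0"
    proof (cases "t = 2")
      case True
      then have "1 - \<alpha> * 2 > 0" using False t \<alpha> by (auto simp: field_simps)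
      then have "x t > 0" using True by (simp add: x_def)
      then show ?thesis by (simp add: add_pos_nonneg)
    qed (simp add: add_nonneg_pos)
    ultimately show ?thesis by (simp add: add_nonneg_pos)
  qed
  show ?thesis
  proof (rule that[of h])
    show "continuous_on {1..1 / \<alpha>} h"
      unfolding h_def x_def using pos[unfolded x_def] by (intro continuous_intros) (metis less_irrefl)
    show "h 1 = pi / 2" by (rule ends) (auto simp: x_def)
    show "h (1 / \<alpha>) = (if \<alpha> = 1 / 2 then 0 else pi / 2)"
    proof -
      have "1 / \<alpha> \<noteq> 2" using False \<alpha> by (auto simp: field_simps)
      then show ?thesis using False \<alpha> by (simp add: ends x_def)
    qed
    fix t assume t: "1 < t" "t < 1 / \<alpha>"
    then have "(1 - \<alpha> * t) * (t - 1) > 0" using \<alpha> by (intro mult_pos_pos) (auto simp: field_simps)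
    then have "x t > 0" by (simp add: x_def)
    then show "h t = arctan ((t - 2)\<^sup>2 / (4 * sqrt ((1 - \<alpha> * t) * (t - 1))))"
      using arctan_divide_half[of "x t" "(t - 2)\<^sup>2"] by (simp add: h_def x_def)
  qed
next
  case True
  have inv\<alpha>: "1 / \<alpha> = 2" unfolding True by simp
  define r where "r = (\<lambda>t::real. 8 * (t - 1))"
  define h where "h = (\<lambda>t::real. 2 * arctan ((2 - t) * sqrt (2 - t) / (sqrt (r t) + sqrt (r t + (2 - t) ^ 3))))"
  have pos: "sqrt (r t) + sqrt (r t + (2 - t) ^ 3) > 0" if t: "t \<in> {1..2}" for t
  proof (cases "t = 1")
    case False
    then have "r t > 0" using t by (simp add: r_def)
    moreover have "(2 - t) ^ 3 \<ge> 0" using t by simp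
    ultimately show ?thesis by (intro add_pos_nonneg) auto
  qed (simp add: r_def)
  show ?thesis
  proof (rule that[of h])
    show "continuous_on {1..1 / \<alpha>} h"
      unfolding inv\<alpha> h_def r_def using pos[unfolded r_def]
      by (intro continuous_intros) (metis less_irrefl)
    show "h 1 = pi / 2" by (simp add: h_def r_def arctan_one)
    show "h (1 / \<alpha>) = (if \<alpha> = 1 / 2 then 0 else pi / 2)" unfolding h_def inv\<alpha> using True by simp
    fix t assume "1 < t" "t < 1 / \<alpha>"
    then have t: "1 < t" "t < 2" using True by auto
    define s where "s = sqrt (2 - t)"
    have s: "s > 0" "2 - t = s\<^sup>2" using t by (auto simp: s_def)
    have rpos: "sqrt (r t) > 0" using t by (simp add: r_def)
    have x: "4 * sqrt ((1 - \<alpha> * t) * (t - 1)) = s * sqrt (r t)"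
    proof -
      have "4 * sqrt ((1 - \<alpha> * t) * (t - 1)) = sqrt (16 * ((1 - \<alpha> * t) * (t - 1)))"
        by (simp add: real_sqrt_mult)
      also have "16 * ((1 - \<alpha> * t) * (t - 1)) = s\<^sup>2 * r t"
        unfolding s(2)[symmetric] True r_def by (simp add: field_simps)
      finally show ?thesis using s(1) by (simp add: real_sqrt_mult)
    qed
    have y: "(t - 2)\<^sup>2 = s ^ 4"
      using arg_cong[OF s(2), of "\<lambda>x. x\<^sup>2"] by (simp add: power2_commute)
    have "(s * sqrt (r t))\<^sup>2 + (s ^ 4)\<^sup>2 = s\<^sup>2 * (r t + (2 - t) ^ 3)"
      unfolding s(2) using rpos by (simp add: algebra_simps power_mult_distrib flip: power_add power_mult)
    then have hyp: "sqrt ((s * sqrt (r t))\<^sup>2 + (s ^ 4)\<^sup>2) = s * sqrt (r t + (2 - t) ^ 3)"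
      using s(1) by (simp add: real_sqrt_mult)
    have "arctan (s ^ 4 / (s * sqrt (r t))) = 2 * arctan (s ^ 4 / (s * (sqrt (r t) + sqrt (r t + (2 - t) ^ 3))))"
      using arctan_divide_half[of "s * sqrt (r t)" "s ^ 4"] s(1) rpos unfolding hyp by (simp add: distrib_left)
    also have "s ^ 4 / (s * (sqrt (r t) + sqrt (r t + (2 - t) ^ 3))) =
        s\<^sup>2 * s / (sqrt (r t) + sqrt (r t + (2 - t) ^ 3))"
      using s(1) by (simp add: power4_eq_xxxx power2_eq_square)
    finally show "h t = arctan ((t - 2)\<^sup>2 / (4 * sqrt ((1 - \<alpha> * t) * (t - 1))))"
      unfolding x y h_def s(2)[symmetric] by (simp add: s_def)
  qed
qed

lemma rayleigh_integral:
  assumes k: "k \<ge> 1"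
  shows "2 * real k * integral {sqrt \<alpha>..1} (\<lambda>\<tau>. \<tau> ^ (2 * k - 1) *
      arctan ((1 / \<tau>\<^sup>2 - 2)\<^sup>2 / (4 * sqrt ((1 - \<alpha> / \<tau>\<^sup>2) * (1 / \<tau>\<^sup>2 - 1))))) =
    pi / 2 - \<alpha> ^ k * (if \<alpha> = 1 / 2 then 0 else pi / 2) -
    2 * pi * arcsine_mean \<alpha> (\<lambda>t. (t - 2) * rayleigh_numerator \<alpha> t / rayleigh_cubic \<alpha> t / t ^ Suc k)"
proof -
  obtain h where h: "continuous_on {1..1 / \<alpha>} h"
    "h 1 = pi / 2" "h (1 / \<alpha>) = (if \<alpha> = 1 / 2 then 0 else pi / 2)"
    "\<And>t. 1 < t \<Longrightarrow> t < 1 / \<alpha> \<Longrightarrow> h t = arctan ((t - 2)\<^sup>2 / (4 * sqrt ((1 - \<alpha> * t) * (t - 1))))"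
    using rayleigh_angle_extension by blast
  let ?S = "\<lambda>t. - 2 * ((t - 2) * rayleigh_numerator \<alpha> t / rayleigh_cubic \<alpha> t)"
  have "integral {sqrt \<alpha>..1} (\<lambda>\<tau>. \<tau> ^ (2 * k - 1) *
      arctan ((1 / \<tau>\<^sup>2 - 2)\<^sup>2 / (4 * sqrt ((1 - \<alpha> / \<tau>\<^sup>2) * (1 / \<tau>\<^sup>2 - 1))))) =
    integral {sqrt \<alpha>..1} (\<lambda>\<tau>. \<tau> ^ (2 * k - 1) * h (1 / \<tau>\<^sup>2))"
  proof (rule integral_spike[of "{sqrt \<alpha>, 1}"])
    fix \<tau> assume "\<tau> \<in> {sqrt \<alpha>..1} - {sqrt \<alpha>, 1}"
    then have \<tau>: "sqrt \<alpha> < \<tau>" "\<tau> < 1" by auto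
    then have "(sqrt \<alpha>)\<^sup>2 < \<tau>\<^sup>2" using \<alpha> by (intro power_strict_mono) auto
    then have "\<alpha> < \<tau>\<^sup>2" using \<alpha> by simp
    moreover have "\<tau> > 0" using \<tau> \<alpha> real_sqrt_gt_zero[of \<alpha>] by linarith
    then have "\<tau>\<^sup>2 < 1" "\<tau>\<^sup>2 > 0" using \<tau> by (auto simp: power_less_one_iff)
    ultimately have "1 < 1 / \<tau>\<^sup>2" "1 / \<tau>\<^sup>2 < 1 / \<alpha>" using \<alpha> by (auto simp: divide_simps)
    from h(4)[OF this] show "\<tau> ^ (2 * k - 1) * h (1 / \<tau>\<^sup>2) = \<tau> ^ (2 * k - 1) *
      arctan ((1 / \<tau>\<^sup>2 - 2)\<^sup>2 / (4 * sqrt ((1 - \<alpha> / \<tau>\<^sup>2) * (1 / \<tau>\<^sup>2 - 1))))" by simp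
  qed simp
  moreover have "2 * real k * integral {sqrt \<alpha>..1} (\<lambda>\<tau>. \<tau> ^ (2 * k - 1) * h (1 / \<tau>\<^sup>2)) =
    h 1 - \<alpha> ^ k * h (1 / \<alpha>) + pi * arcsine_mean \<alpha> (\<lambda>t. ?S t / t ^ Suc k)"
  proof (rule power_integral_by_parts[OF k h(1)])
    fix t assume t: "1 < t" "t < 1 / \<alpha>"
    show "(h has_real_derivative ?S t / (t * sqrt ((1 - \<alpha> * t) * (t - 1)))) (at t)"
      by (rule has_field_derivative_transform_within_open[OF rayleigh_angle_deriv[OF t], of "{1<..<1 / \<alpha>}"])
        (use t h(4) in auto)
  qed
  moreover have "arcsine_mean \<alpha> (\<lambda>t. ?S t / t ^ Suc k) =
      - 2 * arcsine_mean \<alpha> (\<lambda>t. (t - 2) * rayleigh_numerator \<alpha> t / rayleigh_cubic \<alpha> t / t ^ Suc k)"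
    unfolding arcsine_mean_def times_divide_eq_right[symmetric] integral_mult_right by simp
  ultimately show ?thesis using h(2,3) by simp
qed

text \<open>The differentiated function splits as \<open>4 P / ((z - 2) C) + (z - 2) P / (C \<surd>p)\<close>. The second summand is the
  Cauchy transform \<open>K\<close> plus \<open>\<Sum> a\<^sub>i J(w\<^sub>i) / (z - w\<^sub>i)\<close>. Adding the residues \<open>w\<^sub>i / 4\<close> of the first summand
  doubles the contribution of the inner root and cancels those of the outer ones. If \<open>\<alpha> = 1/2\<close>, the
  outer root \<open>2\<close> has \<open>a\<^sub>i = 0\<close>, so its residue \<open>1/2\<close> survives and changes the coefficient of
  \<open>(1/2)\<^sup>k\<close> from \<open>1\<close> to \<open>3/4\<close>.\<close>

lemma rayleigh_mean_deriv:
  "(deriv ^^ k) (\<lambda>t. (rayleigh_numerator \<alpha> t * (4 * sqrt ((1 - \<alpha> * t) * (1 - t)) + (t - 2)\<^sup>2)) /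
      ((t - 2) * rayleigh_cubic \<alpha> t * sqrt ((1 - \<alpha> * t) * (1 - t)))) 0 =
    fact k * (arcsine_mean \<alpha> (\<lambda>t. (t - 2) * rayleigh_numerator \<alpha> t / rayleigh_cubic \<alpha> t / t ^ Suc k)
      - (1 / 2) * (1 / rayleigh_root \<alpha>) ^ k + (if \<alpha> = 1 / 2 then 3 / 4 else 1) * (1 / 2) ^ k)"
proof -
  define N where "N = (\<lambda>t. (t - 2) * rayleigh_numerator \<alpha> t)"
  define C where "C = rayleigh_cubic \<alpha>"
  define w0 where "w0 = rayleigh_root \<alpha>"
  have w0: "0 < w0" "w0 < 1" "C w0 = 0" using rayleigh_root(1-3) by (auto simp: w0_def C_def)
  define e2 where "e2 = 24 - 16 * \<alpha> - w0 * (8 - w0)"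
  define d where "d = csqrt ((of_real (8 - w0) / 2)\<^sup>2 - of_real e2)"
  define u where "u = of_real (8 - w0) / 2 + d"
  define v where "v = of_real (8 - w0) / 2 - d"
  have sum: "u + v = of_real (8 - w0)" "v + u = of_real (8 - w0)" by (auto simp: u_def v_def)
  have "u * v = (of_real (8 - w0) / 2)\<^sup>2 - d\<^sup>2"
    by (simp add: u_def v_def algebra_simps power2_eq_square)
  then have prod: "u * v = of_real (24 - 16 * \<alpha> - w0 * (8 - w0))" "v * u = of_real (24 - 16 * \<alpha> - w0 * (8 - w0))"
    by (simp_all add: d_def e2_def mult.commute)
  define a where "a = complex_of_real \<alpha>"
  define x where "x = complex_of_real w0"
  have v1: "x + u + v = 8" using sum by (simp add: x_def add.assoc)
  have "x * u + x * v + u * v = x * (u + v) + u * v" by (simp add: algebra_simps)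
  also have "\<dots> = 24 - 16 * a" unfolding sum prod by (simp add: a_def x_def)
  finally have v2: "x * u + x * v + u * v = 24 - 16 * a" .
  have v3: "x * u * v = 16 * (1 - a)"
  proof -
    have "w0 * (24 - 16 * \<alpha> - w0 * (8 - w0)) = 16 * (1 - \<alpha>)"
      using w0(3) by (simp add: C_def rayleigh_cubic_def algebra_simps power2_eq_square power3_eq_cube)
    from arg_cong[OF this, of complex_of_real] show ?thesis
      unfolding mult.assoc prod x_def a_def by simp
  qed
  have Cfac: "complex_of_real (C t) = (of_real t - x) * (of_real t - u) * (of_real t - v)" for t
    unfolding rayleigh_cubic_of_roots[OF v1 v2 v3] by (simp add: C_def rayleigh_cubic_def a_def)
  have Pid: "16 * complex_of_real (rayleigh_numerator \<alpha> t) + 8 * of_real (C t) =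
      (of_real t - 2) * (x * (of_real t - u) * (of_real t - v) + u * (of_real t - x) * (of_real t - v) + v * (of_real t - x) * (of_real t - u))" for t
    using rayleigh_numerator_of_roots[OF v1 v2 v3, of "of_real t"] unfolding Cfac by (simp add: rayleigh_numerator_def a_def)
  have Nid: "16 * complex_of_real (N t) = 32 * a * of_real (C t) +
      x * (x - 2)\<^sup>2 * (of_real t - u) * (of_real t - v) + u * (u - 2)\<^sup>2 * (of_real t - x) * (of_real t - v) +
      v * (v - 2)\<^sup>2 * (of_real t - x) * (of_real t - u)" for t
    using shifted_numerator_of_roots[OF v1 v2 v3, of "of_real t"] unfolding Cfac by (simp add: N_def rayleigh_numerator_def a_def)
  define w where "w = (\<lambda>i::nat. if i = 0 then x else if i = 1 then u else v)"
  define b where "b = (\<lambda>i. w i * (w i - 2)\<^sup>2 / 16)"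
  have w_vals: "w 0 = x" "w 1 = u" "w 2 = v" by (simp_all add: w_def)
  have three: "(\<Sum>i<3. f i) = f 0 + f 1 + f 2" for f :: "nat \<Rightarrow> complex"
    by (simp add: eval_nat_numeral)
  have S_eq: "2 * a + (\<Sum>i<3. b i / (of_real t - w i)) = complex_of_real (N t / C t)" if "C t \<noteq> 0" for t
  proof -
    have nz: "of_real t - x \<noteq> 0" "of_real t - u \<noteq> 0" "of_real t - v \<noteq> 0"
      using that Cfac[of t] by auto
    have e: "p / 16 / X * (16 * (X * U * V)) = p * U * V" "p / 16 / U * (16 * (X * U * V)) = p * X * V"
        "p / 16 / V * (16 * (X * U * V)) = p * X * U" if "X \<noteq> 0" "U \<noteq> 0" "V \<noteq> 0" for p X U V :: complex
      using that by auto
    have "(2 * a + (\<Sum>i<3. b i / (of_real t - w i))) * (16 * complex_of_real (C t)) = 16 * complex_of_real (N t)"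
      unfolding three Nid Cfac b_def distrib_right w_vals e[OF nz] by simp
    moreover have "16 * complex_of_real (C t) \<noteq> 0" using that by simp
    ultimately have "2 * a + (\<Sum>i<3. b i / (of_real t - w i)) = 16 * complex_of_real (N t) / (16 * complex_of_real (C t))"
      using nonzero_eq_divide_eq by blast
    then show ?thesis by simp
  qed
  have P_eq: "4 * complex_of_real (rayleigh_numerator \<alpha> t) / ((of_real t - 2) * of_real (C t)) =
      - 2 / (of_real t - 2) + (\<Sum>i<3. w i / 4 / (of_real t - w i))" if "C t \<noteq> 0" "t \<noteq> 2" for t
  proof -
    have "complex_of_real t \<noteq> of_real 2" using that(2) unfolding of_real_eq_iff .
    then have nz: "of_real t - x \<noteq> 0" "of_real t - u \<noteq> 0" "of_real t - v \<noteq> 0" "of_real t - (2::complex) \<noteq> 0"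
      using that(1) Cfac[of t] by auto
    have e: "p / 4 / X * (4 * (X * U * V)) = p * U * V" "p / 4 / U * (4 * (X * U * V)) = p * X * V"
        "p / 4 / V * (4 * (X * U * V)) = p * X * U" if "X \<noteq> 0" "U \<noteq> 0" "V \<noteq> 0" for p X U V :: complex
      using that by auto
    have "(\<Sum>i<3. w i / 4 / (of_real t - w i)) * (4 * complex_of_real (C t)) =
        x * (of_real t - u) * (of_real t - v) + u * (of_real t - x) * (of_real t - v) + v * (of_real t - x) * (of_real t - u)"
      unfolding three Cfac distrib_right w_vals e[OF nz(1-3)] by simp
    then have P: "16 * complex_of_real (rayleigh_numerator \<alpha> t) =
        (of_real t - 2) * ((\<Sum>i<3. w i / 4 / (of_real t - w i)) * (4 * complex_of_real (C t))) - 8 * of_real (C t)"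
      using Pid[of t] by (simp only: eq_diff_eq)
    have "4 * p / (y * c) = - 2 / y + s" if "16 * p = y * (s * (4 * c)) - 8 * c" "y \<noteq> 0" "c \<noteq> 0" for p y c s :: complex
    proof -
      have "4 * (4 * p) = 4 * ((y * s - 2) * c)" using that(1) by (simp add: algebra_simps)
      then have "4 * p = (y * s - 2) * c" by (simp only: mult_cancel_left) simp
      then show ?thesis using that(2,3) by (simp add: field_simps)
    qed
    from this[OF P nz(4)] show ?thesis using that(1) by simp
  qed
  define J where "J = (\<lambda>w::complex. arcsine_mean \<alpha> (\<lambda>t. 1 / (of_real t - w)))"
  have x_out: "x \<notin> of_real ` {1..1 / \<alpha>}" "x \<noteq> 2"
    using w0 of_real_eq_iff[of w0 2, where 'a = complex] by (auto simp: x_def)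
  have out: "w i \<notin> of_real ` {1..1 / \<alpha>}" if "w i \<noteq> 2" for i
    using that x_out rayleigh_residue_outer(1)[folded w0_def, OF sum(1) prod(1)]
      rayleigh_residue_outer(1)[folded w0_def, OF sum(2) prod(2)]
    by (auto simp: w_def split: if_splits)
  have res0: "b 0 * J (w 0) = w 0 / 4"
    using rayleigh_residue_inner by (simp add: b_def w_def J_def x_def w0_def)
  have res: "b i * J (w i) = (if w i = 2 then 0 else - (w i / 4))" if "i > 0" for i
    using that rayleigh_residue_outer(2)[folded w0_def, OF sum(1) prod(1)]
      rayleigh_residue_outer(2)[folded w0_def, OF sum(2) prod(2)]
    by (auto simp: b_def w_def J_def)
  have two: "(\<Sum>i\<in>{1, 2}. (if w i = 2 then 1 / 2 else 0) / (y - w i)) = (if \<alpha> = 1 / 2 then 1 / 2 / (y - 2) else 0)" for y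
  proof -
    have "complex_of_real (C 2) = (2 - x) * (2 - u) * (2 - v)" using Cfac[of 2] by simp
    moreover have "C 2 = 8 - 16 * \<alpha>" by (simp add: C_def rayleigh_cubic_def)
    ultimately have "complex_of_real (8 - 16 * \<alpha>) = (2 - x) * (2 - u) * (2 - v)" by simp
    then have "u = 2 \<or> v = 2 \<longleftrightarrow> complex_of_real (8 - 16 * \<alpha>) = 0" using x_out(2) by auto
    then have iff: "u = 2 \<or> v = 2 \<longleftrightarrow> \<alpha> = 1 / 2" unfolding of_real_eq_0_iff by auto
    have "\<not> (u = 2 \<and> v = 2)"
    proof
      assume "u = 2 \<and> v = 2"
      then have "complex_of_real 4 = of_real (8 - w0)" using sum by simp
      then show False using w0 unfolding of_real_eq_iff by simp
    qed
    then show ?thesis using iff by (auto simp: w_def)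
  qed
  \<comment> \<open>The continuous extension of \<open>N / C\<close> to the closed cut; it differs from the quotient only if \<open>C\<close>
    vanishes at an end point.\<close>
  define G where "G = (\<lambda>t. Re (2 * a + (\<Sum>i<3. b i / (of_real t - w i))))"
  have Gcont: "continuous_on {1..1 / \<alpha>} G"
  proof -
    have "continuous_on {1..1 / \<alpha>} (\<lambda>t. b i / (of_real t - w i))" for i
    proof (cases "w i = 2")
      case False
      have "complex_of_real t - w i \<noteq> 0" if "t \<in> {1..1 / \<alpha>}" for t
        using out[OF False] that by (metis imageI right_minus_eq)
      then show ?thesis by (intro continuous_intros) blast
    qed (simp add: b_def)
    then show ?thesis unfolding G_def
      by (intro continuous_on_Re continuous_on_add continuous_on_const continuous_on_sum)
  qed
  have G_eq: "complex_of_real (G t) = 2 * a + (\<Sum>i<3. b i / (of_real t - w i))" "G t = N t / C t"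
    if "1 < t" "t < 1 / \<alpha>" for t
  proof -
    have C: "C t \<noteq> 0" using rayleigh_cubic_pos[OF that] by (simp add: C_def)
    show G: "G t = N t / C t" unfolding G_def S_eq[OF C] by simp
    show "complex_of_real (G t) = 2 * a + (\<Sum>i<3. b i / (of_real t - w i))"
      unfolding G S_eq[OF C] ..
  qed
  let ?\<kappa> = "\<lambda>n. arcsine_mean \<alpha> (\<lambda>t. G t / t ^ Suc n)"
  let ?f = "\<lambda>t. (rayleigh_numerator \<alpha> t * (4 * sqrt ((1 - \<alpha> * t) * (1 - t)) + (t - 2)\<^sup>2)) /
      ((t - 2) * C t * sqrt ((1 - \<alpha> * t) * (1 - t)))"
  define \<epsilon> where "\<epsilon> = (if \<alpha> = 1 / 2 then 3 / 4 else 1 :: real)"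
  \<comment> \<open>The nearest pole is the inner root, which bounds the radius of convergence.\<close>
  have "(deriv ^^ k) ?f 0 = fact k * (?\<kappa> k - (1 / 2) * (1 / w0) ^ k + \<epsilon> * (1 / 2) ^ k)"
  proof (rule higher_deriv_at_0_of_sums[OF w0(1)])
    fix z assume z: "\<bar>z\<bar> < w0"
    have z1: "\<bar>z\<bar> < 1" "z < 1" "z \<noteq> 2" "z \<noteq> w0" "\<bar>z\<bar> < 2" using z w0 by auto
    have Cz: "C z \<noteq> 0"
    proof
      assume C0: "C z = 0"
      have "z \<le> 0"
        using rayleigh_root(4)[of z] C0 z1 unfolding C_def w0_def by force
      then have "z ^ 3 \<le> 0" "8 * (3 - 2 * \<alpha>) * z \<le> 0" "16 * (\<alpha> - 1) < 0" "8 * z\<^sup>2 \<ge> 0"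
        using \<alpha> by (auto simp: power3_eq_cube mult_nonneg_nonpos mult_nonpos_nonpos)
      then have "C z < 0" unfolding C_def rayleigh_cubic_def by linarith
      then show False using C0 by simp
    qed
    define r where "r = 1 / sqrt ((1 - \<alpha> * z) * (1 - z))"
    have p: "sqrt ((1 - \<alpha> * z) * (1 - z)) > 0"
    proof -
      have "\<alpha> * z < 1"
      proof (cases "z \<ge> 0")
        case True
        then have "\<alpha> * z \<le> 1 * z" using \<alpha> by (intro mult_right_mono) auto
        then show ?thesis using z1 by simp
      next
        case False
        then have "\<alpha> * z \<le> 0" using \<alpha> by (intro mult_nonneg_nonpos) auto
        then show ?thesis by simp
      qed
      then show ?thesis using z1 by simp
    qed
    have wz: "w i \<noteq> of_real z" if "i < 3" for i
      using that Cz Cfac[of z] by (auto simp: w_def split: if_splits)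
    have Jz: "J (of_real z) = of_real r"
      using cauchy_transform_real[of z] z1 unfolding J_def r_def by simp
    have cont: "continuous_on {1..1 / \<alpha>} (\<lambda>t. G t / (t - z))"
      using z1 by (intro continuous_intros Gcont) auto
    define K where "K = arcsine_mean \<alpha> (\<lambda>t. G t / (t - z))"
    have "complex_of_real K =
        arcsine_mean \<alpha> (\<lambda>t. (2 * a + (\<Sum>i<3. b i / (of_real t - w i))) / (of_real t - of_real z))"
      unfolding K_def arcsine_mean_of_real[OF cut_pt_integrable[OF cont], symmetric]
      by (rule arcsine_mean_cong) (simp add: G_eq(1))
    also have "\<dots> = (2 * a + (\<Sum>i<3. b i / (of_real z - w i))) * J (of_real z) -
        (\<Sum>i<3. b i * J (w i) / (of_real z - w i))"
      unfolding J_def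
    proof (rule cauchy_transform_partial_fractions)
      show "complex_of_real z \<notin> of_real ` {1..1 / \<alpha>}" using z1 by auto
      show "w i \<notin> of_real ` {1..1 / \<alpha>}" if "b i \<noteq> 0" for i
        using out[of i] that by (auto simp: b_def)
    qed (use wz in auto)
    also have "\<dots> = complex_of_real (N z / C z * r) - (\<Sum>i<3. b i * J (w i) / (of_real z - w i))"
      unfolding S_eq[OF Cz] Jz by simp
    finally have K: "complex_of_real (N z / C z * r) = complex_of_real K + (\<Sum>i<3. b i * J (w i) / (of_real z - w i))"
      by simp
    have f_eq: "?f z = 4 * rayleigh_numerator \<alpha> z / ((z - 2) * C z) + N z / C z * r"
    proof -
      have "P * (4 * s + y\<^sup>2) / (y * c * s) = 4 * P / (y * c) + y * P / c * (1 / s)"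
        if "y \<noteq> 0" "c \<noteq> 0" "s > 0" for P s y c :: real
        using that by (simp add: field_simps power2_eq_square)
      from this[OF _ Cz p, of "z - 2"] show ?thesis unfolding N_def r_def using z1(3) by simp
    qed
    have "complex_of_real (?f z) = - 2 / (of_real z - 2) + complex_of_real K +
        ((\<Sum>i<3. w i / 4 / (of_real z - w i)) + (\<Sum>i<3. b i * J (w i) / (of_real z - w i)))"
      unfolding f_eq of_real_add K using P_eq[OF Cz z1(3)] by simp
    also have "(\<Sum>i<3. w i / 4 / (of_real z - w i)) + (\<Sum>i<3. b i * J (w i) / (of_real z - w i)) =
        x / 2 / (of_real z - x) + (\<Sum>i\<in>{1, 2}. (if w i = 2 then 1 / 2 else 0) / (of_real z - w i))"
    proof -
      have first: "w 0 / 4 / y + b 0 * J (w 0) / y = x / 2 / y" for y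
        unfolding res0 add_divide_distrib[symmetric]
        by (rule arg_cong[where f = "\<lambda>q. q / y"]) (simp add: w_vals(1))
      have others: "w i / 4 / y + b i * J (w i) / y = (if w i = 2 then 1 / 2 else 0) / y" if "i > 0" for i y
        unfolding res[OF that] add_divide_distrib[symmetric] by (rule arg_cong[where f = "\<lambda>q. q / y"]) simp
      have pair: "sum g {1, 2} = g 1 + g 2" for g :: "nat \<Rightarrow> complex" by simp
      have "(\<Sum>i<3. w i / 4 / (of_real z - w i)) + (\<Sum>i<3. b i * J (w i) / (of_real z - w i)) =
          (w 0 / 4 / (of_real z - w 0) + b 0 * J (w 0) / (of_real z - w 0)) +
          ((w 1 / 4 / (of_real z - w 1) + b 1 * J (w 1) / (of_real z - w 1)) +
           (w 2 / 4 / (of_real z - w 2) + b 2 * J (w 2) / (of_real z - w 2)))"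
        unfolding three by (simp only: add_ac)
      also have "\<dots> = x / 2 / (of_real z - w 0) + (\<Sum>i\<in>{1, 2}. (if w i = 2 then 1 / 2 else 0) / (of_real z - w i))"
        unfolding first others[OF zero_less_one] others[OF zero_less_numeral] pair ..
      finally show ?thesis unfolding w_vals(1) .
    qed
    also have "\<dots> = x / 2 / (of_real z - x) + (if \<alpha> = 1 / 2 then 1 / 2 / (of_real z - 2) else 0)"
      unfolding two ..
    also have "- 2 / (of_real z - 2) + complex_of_real K + (x / 2 / (of_real z - x) + (if \<alpha> = 1 / 2 then 1 / 2 / (of_real z - 2) else 0))
       = complex_of_real (K + (- (1 / 2)) * (w0 / (w0 - z)) + \<epsilon> * (2 / (2 - z)))"
    proof -
      have "complex_of_real (w0 / 2 / (z - w0)) = complex_of_real (- (1 / 2) * (w0 / (w0 - z)))"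
        using z1 by (simp only: of_real_eq_iff) (simp add: divide_simps, simp add: algebra_simps)
      moreover have "complex_of_real (- 2 / (z - 2) + (if \<alpha> = 1 / 2 then 1 / 2 / (z - 2) else 0)) =
          complex_of_real (\<epsilon> * (2 / (2 - z)))"
        using z1 unfolding \<epsilon>_def by (simp only: of_real_eq_iff) (simp add: divide_simps, simp add: algebra_simps)
      ultimately show ?thesis unfolding of_real_add by (auto simp: x_def split: if_splits)
    qed
    finally have f_val: "?f z = K + (- (1 / 2)) * (w0 / (w0 - z)) + \<epsilon> * (2 / (2 - z))"
      unfolding of_real_eq_iff .
    have "(\<lambda>n. ?\<kappa> n * z ^ n + (- (1 / 2)) * ((1 / w0) ^ n * z ^ n) + \<epsilon> * ((1 / 2) ^ n * z ^ n)) sums ?f z"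
      unfolding f_val K_def
      by (intro sums_add sums_mult geometric_sums_shifted cauchy_transform_sums[OF Gcont] z1 z)
    then show "(\<lambda>n. (?\<kappa> n - (1 / 2) * (1 / w0) ^ n + \<epsilon> * (1 / 2) ^ n) * z ^ n) sums ?f z"
      by (simp add: algebra_simps)
  qed
  moreover have "?\<kappa> k = arcsine_mean \<alpha> (\<lambda>t. N t / C t / t ^ Suc k)"
    by (rule arcsine_mean_cong) (simp add: G_eq(2))
  ultimately show ?thesis by (simp add: N_def C_def w0_def \<epsilon>_def)
qed

end

section \<open>The two Weyl coefficients\<close>

theorem theorem1p10:
  fixes k d :: nat and lam mu \<alpha> :: real
  assumes "k \<ge> 1" and "d = 2 * k + 1"
    and "mu > 0" and "real d * lam + 2 * mu > 0"
    and "\<alpha> = elastic_alpha lam mu"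
  shows "b_Dir d lam mu =
      - (mu powi (- int k) / (2 ^ (2 * k + 2) * fact k * pi ^ k)) *
        (2 / fact k *
           (deriv ^^ k) (\<lambda>t. (2 * t - (\<alpha> + 1) / \<alpha>) / (t - (\<alpha> + 1) / \<alpha>) *
                             (1 / sqrt ((1 - \<alpha> * t) * (1 - t)))) 0
         - 2 * (\<alpha> / (\<alpha> + 1)) ^ k + \<alpha> ^ k + 2 * real k)
    \<and> b_free d lam mu =
      mu powi (- int k) / (2 ^ (2 * k + 2) * fact k * pi ^ k) *
        (- (8 / fact k) *
           (deriv ^^ k) (\<lambda>t.
              ((2 * \<alpha> * t\<^sup>2 + (\<alpha> - 3) * t + 2 * (1 - \<alpha>)) *
                 (4 * sqrt ((1 - \<alpha> * t) * (1 - t)) + (t - 2)\<^sup>2)) /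
              ((t - 2) * (t ^ 3 - 8 * t\<^sup>2 + 8 * (3 - 2 * \<alpha>) * t + 16 * (\<alpha> - 1)) *
                 sqrt ((1 - \<alpha> * t) * (1 - t)))) 0
         - \<alpha> ^ k + 2 * (real k + 2 powi (2 - int k) - 1))"
proof -
  have \<alpha>: "0 < \<alpha>" "\<alpha> < 1"
    using elastic_alpha_bounds[of d mu lam] assms by auto
  define pre where "pre = mu powi (- int k) / (2 ^ (2 * k + 2) * fact k * pi ^ k)"
  have half: "(1 - real d) / 2 = - real k" "(real d - 1) / 2 = real k" "(real d + 1) / 2 = 1 + real k"
    using assms(2) by auto
  have pre: "mu powr ((1 - real d) / 2) / (2 ^ (d + 1) * pi powr ((real d - 1) / 2) * Gamma ((real d + 1) / 2)) = pre"
  proof -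
    have "Gamma (1 + real k) = fact k" by (simp add: Gamma_fact)
    then show ?thesis
      unfolding pre_def half using assms(2,3)
      by (simp add: powr_minus powr_realpow power_int_minus)
  qed
  have powers: "\<tau> powi (-2) = 1 / \<tau>\<^sup>2" "\<alpha> * (1 / \<tau>\<^sup>2) = \<alpha> / \<tau>\<^sup>2" for \<tau> :: real
    by (auto simp: power_int_minus divide_inverse)
  have d2: "d - 2 = 2 * k - 1" "real d - 1 = 2 * real k" "\<alpha> powr ((real d - 1) / 2) = \<alpha> ^ k"
    using assms(2) \<alpha> by (auto simp: powr_realpow)
  have pull: "4 * (2 * real k) / pi * I = 4 / pi * (2 * real k * I)" for I by simp

  define M where "M = arcsine_mean \<alpha> (\<lambda>t. (1 + (\<alpha> + 1) / \<alpha> / 2 / (t - (\<alpha> + 1) / \<alpha>)) / t ^ Suc k)"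
  have "b_Dir d lam mu = - pre * (4 / pi * (pi * M) + \<alpha> ^ k + 2 * real k)"
    unfolding b_Dir_def Let_def assms(5)[symmetric] unfolding pre d2(3)
    unfolding powers add_diff_eq[symmetric] d2(1,2) pull
      dirichlet_integral[OF \<alpha> assms(1), folded M_def] by simp
  moreover have "2 / fact k * (deriv ^^ k) (\<lambda>t. (2 * t - (\<alpha> + 1) / \<alpha>) / (t - (\<alpha> + 1) / \<alpha>) *
      (1 / sqrt ((1 - \<alpha> * t) * (1 - t)))) 0 - 2 * (\<alpha> / (\<alpha> + 1)) ^ k = 4 / pi * (pi * M)"
    unfolding dirichlet_mean_deriv[OF \<alpha>, of k, folded M_def] by simp
  ultimately have dir: "b_Dir d lam mu = - pre * (2 / fact k *
           (deriv ^^ k) (\<lambda>t. (2 * t - (\<alpha> + 1) / \<alpha>) / (t - (\<alpha> + 1) / \<alpha>) *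
                             (1 / sqrt ((1 - \<alpha> * t) * (1 - t)))) 0
         - 2 * (\<alpha> / (\<alpha> + 1)) ^ k + \<alpha> ^ k + 2 * real k)" by simp

  define M' where "M' = arcsine_mean \<alpha> (\<lambda>t. (t - 2) * rayleigh_numerator \<alpha> t / rayleigh_cubic \<alpha> t / t ^ Suc k)"
  define w where "w = rayleigh_root \<alpha>"
  have "w > 0" using rayleigh_root(1)[OF \<alpha>] by (simp add: w_def)
  then have gam: "gamma_R \<alpha> powi (1 - int d) = (1 / w) ^ k"
  proof -
    have "1 - int d = - int (2 * k)" using assms(2) by simp
    then have "gamma_R \<alpha> powi (1 - int d) = inverse (sqrt w ^ (2 * k))"
      by (simp add: gamma_R_def w_def power_int_minus del: of_nat_mult)
    then show ?thesis using \<open>w > 0\<close> by (simp add: power_mult power_inverse divide_inverse)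
  qed
  define B where "B = (if \<alpha> = 1 / 2 then 0 else pi / 2)"
  have free_int: "b_free d lam mu = pre * (4 / pi * (pi / 2 - \<alpha> ^ k * B - 2 * pi * M') + \<alpha> ^ k + real d - 5 + 4 * (1 / w) ^ k)"
    unfolding b_free_def Let_def assms(5)[symmetric] unfolding pre d2(3) gam
    unfolding powers d2(1,2) pull
      rayleigh_integral[OF \<alpha> assms(1), folded M'_def B_def] by simp
  have "L + p + real d - 5 + 4 * W = - E - p + 2 * (real k + H - 1)"
    if "L = 2 - X - 8 * m" "E = 8 * m - 4 * W + e" "e - X = 8 * h - 2 * p" "2 * H = 8 * h" "real d = 2 * real k + 1"
    for L X m W E e h p H
  proof -
    have "e = 8 * h - 2 * p + X" "H = 4 * h" using that(3,4) by linarith+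
    then show ?thesis unfolding that(1,2,5) by simp
  qed
  moreover have "4 / pi * (pi / 2 - \<alpha> ^ k * B - 2 * pi * M') = 2 - 4 * B / pi * \<alpha> ^ k - 8 * M'"
    by (simp add: field_simps)
  moreover define D where "D = (deriv ^^ k) (\<lambda>t.
              ((2 * \<alpha> * t\<^sup>2 + (\<alpha> - 3) * t + 2 * (1 - \<alpha>)) *
                 (4 * sqrt ((1 - \<alpha> * t) * (1 - t)) + (t - 2)\<^sup>2)) /
              ((t - 2) * (t ^ 3 - 8 * t\<^sup>2 + 8 * (3 - 2 * \<alpha>) * t + 16 * (\<alpha> - 1)) *
                 sqrt ((1 - \<alpha> * t) * (1 - t)))) 0"
  define \<epsilon> where "\<epsilon> = (if \<alpha> = 1 / 2 then 3 / 4 else 1 :: real)"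
  have "D = fact k * (M' - (1 / 2) * (1 / w) ^ k + \<epsilon> * (1 / 2) ^ k)"
    using rayleigh_mean_deriv[OF \<alpha>, of k]
    unfolding rayleigh_numerator_def[of \<alpha>] rayleigh_cubic_def D_def[symmetric]
    by (simp only: M'_def w_def \<epsilon>_def rayleigh_numerator_def rayleigh_cubic_def)
  then have "8 / fact k * D = 8 * (M' - (1 / 2) * (1 / w) ^ k + \<epsilon> * (1 / 2) ^ k)" by simp
  then have "8 / fact k * D = 8 * M' - 4 * (1 / w) ^ k + 8 * \<epsilon> * (1 / 2) ^ k"
    by (simp add: algebra_simps)
  \<comment> \<open>The missing pole and the missing boundary angle at \<open>\<alpha> = 1/2\<close> compensate each other.\<close>
  moreover have "8 * \<epsilon> * (1 / 2) ^ k - 4 * B / pi * \<alpha> ^ k = 8 * (1 / 2) ^ k - 2 * \<alpha> ^ k"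
  proof (cases "\<alpha> = 1 / 2")
    case True
    show ?thesis unfolding \<epsilon>_def B_def True by simp
  qed (simp add: \<epsilon>_def B_def)
  moreover have "2 * 2 powi (2 - int k) = 8 * (1 / 2 :: real) ^ k"
    by (simp add: power_int_diff power_divide)
  moreover have "real d = 2 * real k + 1" using assms(2) by simp
  ultimately have "4 / pi * (pi / 2 - \<alpha> ^ k * B - 2 * pi * M') + \<alpha> ^ k + real d - 5 + 4 * (1 / w) ^ k =
      - (8 / fact k * D) - \<alpha> ^ k + 2 * (real k + 2 powi (2 - int k) - 1)" by blast
  then have free: "b_free d lam mu = pre * (- (8 / fact k) * D - \<alpha> ^ k + 2 * (real k + 2 powi (2 - int k) - 1))"
    unfolding free_int by simp
  show ?thesis using dir free unfolding pre_def D_def by blast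
qed

end
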